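(* Let $A,E\in\mathbb{R}^{n\times n}$, $K(z)=(zE-A)^{-1}$, assume the pencil $(A,E)$ is regular, and let $\alpha,\beta\in\mathbb{C}$ be such that $W:=\alpha E+\beta A$ is invertible. Let $\theta_1,\theta_2\in(-\pi,\pi)$ and assume $e^{\mathrm{j}\phi}$ is not an eigenvalue of $(A,E)$ for any $\phi\in\mathbb{R}$ with $\mathrm{wrap}(\phi)\in[\theta_1,\theta_2]$. For $\epsilon\in\mathbb{C}$ put $A_\epsilon:=A+\alpha\epsilon I$, $E_\epsilon:=E-\beta\epsilon I$, $\Gamma(\theta,\epsilon):=(E_\epsilon+A_\epsilon)\tan(\theta/2)-\mathrm{j}(E_\epsilon-A_\epsilon)$, $\eta:=\log\Big(\frac{\tan(\theta_2/2)-\mathrm{j}}{\tan(\theta_1/2)-\mathrm{j}}\Big)$, and $Y_\epsilon:=-\eta I+\log\big(\Gamma(\theta_2,\epsilon)\Gamma(\theta_1,\epsilon)^{-1}\big)$. Let $\psi_1(X):=\sum_{k=0}^\infty\frac{1}{(k+1)!}X^k$. Then $Y:=\lim_{\epsilon\to0}Y_\epsilon=-\eta I+\log\big(\Gamma(\theta_2,0)\Gamma(\theta_1,0)^{-1}\big)$, $\psi_1(Y)$ is invertible with $L:=\lim_{\epsilon\to0}(e^{Y_\epsilon}-I)^{-1}Y_\epsilon=\psi_1(Y)^{-1}$, and $$\int_{\theta_1}^{\theta_2}K(e^{\mathrm{j}\theta})\,d\theta=\frac{1}{\mathrm{j}}W^{-1}\Big(-\alpha L\big(e^{-\mathrm{j}\theta_2}I-e^{-\mathrm{j}\theta_1}e^{Y}\big)+\beta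 Y\Big).$$
   Context: $\mathrm{j}=\sqrt{-1}$. A pencil $(A,E)$ is regular if $\alpha E+\beta A$ is invertible for some complex $\alpha,\beta$; $\lambda$ is an eigenvalue of $(A,E)$ if $\det(A-\lambda E)=0$. $\mathrm{wrap}(\phi)$ is the principal argument of $e^{\mathrm{j}\phi}$, in $(-\pi,\pi]$. $\log$ denotes the principal (scalar or matrix) logarithm; $e^{Y}$ is the matrix exponential.
   Formalization: The formal statement assumes θ₁ < θ₂: for θ₁ = θ₂ the matrix e^{Y_ε} − I is zero, so L is undefined, and for θ₁ > θ₂ the interval [θ₁,θ₂] is empty, so eigenvalues on the integration path are not excluded and the integral may diverge. *)

theory Defs
  imports "HOL-Analysis.Analysis"
begin

definition cmat :: "real^'n^'m \<Rightarrow> complex^'n^'m" where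
  "cmat M = (\<chi> i k. complex_of_real (M $ i $ k))"

definition cscale :: "complex \<Rightarrow> complex^'n^'m \<Rightarrow> complex^'n^'m" (infixr "*\<^sub>M" 75) where
  "c *\<^sub>M M = (\<chi> i k. c * M $ i $ k)"

primrec matpow :: "complex^'n^'n \<Rightarrow> nat \<Rightarrow> complex^'n^'n" where
  "matpow X 0 = mat 1"
| "matpow X (Suc k) = X ** matpow X k"

definition mexp :: "complex^'n^'n \<Rightarrow> complex^'n^'n" where
  "mexp X = (\<Sum>k. (1 / of_nat (fact k)) *\<^sub>M matpow X k)"

definition psi1 :: "complex^'n^'n \<Rightarrow> complex^'n^'n" where
  "psi1 X = (\<Sum>k. (1 / of_nat (fact (k + 1))) *\<^sub>M matpow X k)"

definition mat_eigenvalue :: "complex^'n^'n \<Rightarrow> complex \<Rightarrow> bool" where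
  "mat_eigenvalue X \<mu> \<longleftrightarrow> (\<exists>v. v \<noteq> 0 \<and> X *v v = (\<chi> i. \<mu> * v $ i))"

text \<open>Principal matrix logarithm: the unique logarithm all of whose eigenvalues have
 imaginary part in (-pi, pi) (defined when X has no eigenvalue on the closed negative real axis).\<close>
definition mlog :: "complex^'n^'n \<Rightarrow> complex^'n^'n" where
  "mlog X = (THE Y. mexp Y = X \<and> (\<forall>\<mu>. mat_eigenvalue Y \<mu> \<longrightarrow> - pi < Im \<mu> \<and> Im \<mu> < pi))"

definition regular_pencil :: "real^'n^'n \<Rightarrow> real^'n^'n \<Rightarrow> bool" where
  "regular_pencil A E \<longleftrightarrow> (\<exists>a b. invertible (a *\<^sub>M cmat E + b *\<^sub>M cmat A))"

definition pencil_eigenvalue :: "real^'n^'n \<Rightarrow> real^'n^'n \<Rightarrow> complex \<Rightarrow> bool" where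
  "pencil_eigenvalue A E \<mu> \<longleftrightarrow> det (cmat A - \<mu> *\<^sub>M cmat E) = 0"

definition wrap :: "real \<Rightarrow> real" where
  "wrap \<phi> = Arg (cis \<phi>)"

definition resolvent :: "real^'n^'n \<Rightarrow> real^'n^'n \<Rightarrow> complex \<Rightarrow> complex^'n^'n" where
  "resolvent A E z = matrix_inv (z *\<^sub>M cmat E - cmat A)"

end

theory Submission
  imports Defs "HOL-Computational_Algebra.Fundamental_Theorem_Algebra"
begin

text \<open>
  Put \<open>F = E\<^sub>\<epsilon> W\<^sup>-\<^sup>1\<close> and \<open>G = A\<^sub>\<epsilon> W\<^sup>-\<^sup>1\<close>. Since \<open>\<alpha> E\<^sub>\<epsilon> + \<beta> A\<^sub>\<epsilon> = W\<close> for every \<open>\<epsilon>\<close>,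
  these satisfy \<open>\<alpha> F + \<beta> G = I\<close>, hence commute. The candidate
  \<open>Y\<^sub>\<epsilon> = \<i> G \<integral> (e\<^sup>i\<^sup>\<theta> F - G)\<^sup>-\<^sup>1 d\<theta>\<close> has the right exponential, because its upper-limit
  derivative is the logarithmic derivative of \<open>F - e\<^sup>-\<^sup>i\<^sup>\<theta> G\<close>. On a common eigenvector of \<open>F\<close> and
  \<open>G\<close>, with eigenvalues \<open>f\<close> and \<open>g\<close>, the shifted candidate \<open>\<eta> I + Y\<^sub>\<epsilon>\<close> acts as the logarithm of a
  quotient of two points on the segment \<open>(t - \<i>) f + (t + \<i>) g\<close>, \<open>t = tan (\<theta>/2)\<close>, which avoids
  \<open>0\<close>; so its eigenvalues lie in the principal strip and it is the principal logarithm. In this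
  form \<open>Y\<^sub>\<epsilon>\<close> is visibly continuous in \<open>\<epsilon>\<close>, and \<open>\<psi>\<^sub>1 (Y\<^sub>\<epsilon>)\<close> can be inverted explicitly: for
  \<open>\<epsilon> \<noteq> 0\<close> by cancelling the invertible \<open>G\<close>, for \<open>\<epsilon> = 0\<close> by passing to the limit.
\<close>

subsection \<open>Power series of a matrix\<close>

lemma bilinear_matrix_mult: "bilinear ((**) :: complex^'n^'n \<Rightarrow> complex^'n^'n \<Rightarrow> complex^'n^'n)"
  unfolding bilinear_def
  by (auto intro!: linearI simp: matrix_add_ldistrib vec_eq_iff matrix_matrix_mult_def
      sum.distrib algebra_simps scaleR_sum_right)

lemmas bounded_bilinear_matrix_mult =
  bilinear_matrix_mult [unfolded bilinear_conv_bounded_bilinear]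

interpretation matmult: bounded_bilinear
  "(**) :: complex^'n^'n \<Rightarrow> complex^'n^'n \<Rightarrow> complex^'n^'n"
  by (rule bounded_bilinear_matrix_mult)

lemma bilinear_cscale: "bilinear ((*\<^sub>M) :: complex \<Rightarrow> complex^'n^'n \<Rightarrow> complex^'n^'n)"
  unfolding bilinear_def
  by (auto intro!: linearI simp: vec_eq_iff cscale_def algebra_simps)

interpretation cscale: bounded_bilinear
  "(*\<^sub>M) :: complex \<Rightarrow> complex^'n^'n \<Rightarrow> complex^'n^'n"
  by (rule bilinear_cscale [unfolded bilinear_conv_bounded_bilinear])

lemma bilinear_matrix_vector_mult:
  "bilinear ((*v) :: complex^'n^'n \<Rightarrow> complex^'n \<Rightarrow> complex^'n)"
  unfolding bilinear_def
  by (auto intro!: linearI simp: vec_eq_iff matrix_vector_mult_def sum.distrib algebra_simps scaleR_sum_right)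

interpretation matvec: bounded_bilinear
  "(*v) :: complex^'n^'n \<Rightarrow> complex^'n \<Rightarrow> complex^'n"
  by (rule bilinear_matrix_vector_mult [unfolded bilinear_conv_bounded_bilinear])

lemma cscale_mult_left: "(c *\<^sub>M X) ** Y = c *\<^sub>M (X ** Y)"
  by (simp add: vec_eq_iff cscale_def matrix_matrix_mult_def sum_distrib_left mult.assoc)

lemma cscale_mult_right: "X ** (c *\<^sub>M Y) = c *\<^sub>M (X ** Y)"
  by (simp add: vec_eq_iff cscale_def matrix_matrix_mult_def sum_distrib_left mult_ac)

lemma cscale_cscale: "c *\<^sub>M d *\<^sub>M X = (c * d) *\<^sub>M X"
  by (simp add: vec_eq_iff cscale_def mult.assoc)

lemma cscale_one: "1 *\<^sub>M X = X"
  by (simp add: vec_eq_iff cscale_def)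

lemma cscale_of_real: "complex_of_real r *\<^sub>M X = r *\<^sub>R X"
  by (simp add: vec_eq_iff cscale_def) (simp add: scaleR_conv_of_real)

lemma cscale_matvec: "(c *\<^sub>M X) *v x = c *s (X *v x)"
  by (simp add: vec_eq_iff cscale_def matrix_vector_mult_def sum_distrib_left mult_ac)

lemmas cscale_simps = cscale_mult_left cscale_mult_right cscale_cscale cscale_one

lemma matpow_commute:
  assumes "X ** Y = Y ** X"
  shows "matpow X k ** Y = Y ** matpow X k"
proof (induction k)
  case (Suc k)
  have "matpow X (Suc k) ** Y = X ** (Y ** matpow X k)"
    by (simp add: Suc flip: matrix_mul_assoc)
  also have "\<dots> = Y ** matpow X (Suc k)"
    by (simp add: matrix_mul_assoc assms)
  finally show ?case .
qed simp

text \<open>The norm is used only through bounded bilinearity of the product, whence the constant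
  \<open>K\<close>. The prefactor \<open>norm (mat 1)\<close> stays because it is in general not
  1.\<close>

lemma norm_matmult_bound:
  obtains K where "K > 0"
    "\<And>(X::complex^'n^'n) (Y::complex^'n^'n). norm (X ** Y) \<le> norm X * norm Y * K"
    "\<And>(X :: complex^'n^'n) k. norm (matpow X k) \<le> norm (mat 1 :: complex^'n^'n) * (norm X * K) ^ k"
proof -
  have "\<exists>K>0. \<forall>(X::complex^'n^'n) (Y::complex^'n^'n). norm (X ** Y) \<le> norm X * norm Y * K"
    by (rule matmult.pos_bounded)
  then obtain K where K: "K > 0" "\<And>(X::complex^'n^'n) (Y::complex^'n^'n). norm (X ** Y) \<le> norm X * norm Y * K"
    by auto
  have "norm (matpow X k) \<le> norm (mat 1 :: complex^'n^'n) * (norm X * K) ^ k" for X :: "complex^'n^'n" and k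
  proof (induction k)
    case (Suc k)
    have "norm (matpow X (Suc k)) \<le> norm X * K * norm (matpow X k)"
      using K(2)[of X "matpow X k"] by (simp add: mult_ac)
    also have "\<dots> \<le> norm X * K * (norm (mat 1 :: complex^'n^'n) * (norm X * K) ^ k)"
      using Suc K(1) by (intro mult_left_mono) auto
    finally show ?case by (simp add: mult_ac)
  qed simp
  from that[OF K this] show ?thesis .
qed

text \<open>The exponential series of \<open>r * K\<close> dominates both series on the whole ball
  of radius \<open>r\<close>. Having one majorant independent of \<open>X\<close> is what the
  Weierstrass test needs later.\<close>

lemma matpow_series_bound:
  fixes r :: real
  obtains M where "summable M"
    "\<And>(X :: complex^'n^'n) k. norm X \<le> r \<Longrightarrow> norm (matpow X k /\<^sub>R fact k) \<le> M k"
    "\<And>(X :: complex^'n^'n) k. norm X \<le> r \<Longrightarrow> norm (matpow X k /\<^sub>R fact (k + 1)) \<le> M k"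
proof -
  obtain K where K: "K > 0"
    "\<And>(X :: complex^'n^'n) k. norm (matpow X k) \<le> norm (mat 1 :: complex^'n^'n) * (norm X * K) ^ k"
    using norm_matmult_bound by metis
  define M where "M k = norm (mat 1 :: complex^'n^'n) * ((r * K) ^ k /\<^sub>R fact k)" for k
  have "summable M"
    unfolding M_def by (intro summable_mult summable_exp_generic)
  have B: "norm (matpow X k /\<^sub>R fact k) \<le> M k" if "norm X \<le> r" for X :: "complex^'n^'n" and k
  proof -
    have "norm (matpow X k) \<le> norm (mat 1 :: complex^'n^'n) * (r * K) ^ k"
      using K(1) that
      by (intro order_trans[OF K(2)[of X k]] mult_left_mono power_mono mult_right_mono) auto
    then show ?thesis by (simp add: M_def divide_simps)
  qed
  have "norm (matpow X k /\<^sub>R fact (k + 1)) \<le> M k" if "norm X \<le> r" for X :: "complex^'n^'n" and k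
  proof -
    have "norm (matpow X k /\<^sub>R fact (k + 1)) \<le> norm (matpow X k /\<^sub>R fact k)"
      by (simp add: divide_simps mult_le_cancel_right2 mult_le_cancel_left1)
    then show ?thesis using B[OF that, of k] by linarith
  qed
  from that[OF \<open>summable M\<close> B this] show ?thesis .
qed

lemma mexp_sums: "(\<lambda>k. matpow X k /\<^sub>R fact k) sums mexp X"
  and psi1_sums: "(\<lambda>k. matpow X k /\<^sub>R fact (k + 1)) sums psi1 X"
proof -
  obtain M where M: "summable M" "\<And>k. norm (matpow X k /\<^sub>R fact k) \<le> M k"
    "\<And>k. norm (matpow X k /\<^sub>R fact (k + 1)) \<le> M k"
    using matpow_series_bound[of "norm X"] by (metis order_refl)
  have eq: "(1 / of_nat (fact k)) *\<^sub>M Z = Z /\<^sub>R fact k" for k and Z :: "complex^'n^'n"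
    using cscale_of_real[of "1 / fact k" Z] by (simp add: divide_inverse)
  have "summable (\<lambda>k. matpow X k /\<^sub>R fact k)" "summable (\<lambda>k. matpow X k /\<^sub>R fact (k + 1))"
    by (rule summable_comparison_test'[OF M(1), of 0], rule M)+
  from this[THEN summable_sums] show "(\<lambda>k. matpow X k /\<^sub>R fact k) sums mexp X"
    "(\<lambda>k. matpow X k /\<^sub>R fact (k + 1)) sums psi1 X"
    unfolding mexp_def psi1_def eq .
qed

lemma mexp_0: "mexp (0 :: complex^'n^'n) = mat 1"
proof -
  have "(\<lambda>k. matpow (0 :: complex^'n^'n) k /\<^sub>R fact k) = (\<lambda>k. if k = 0 then mat 1 else 0)"
  proof
    fix k show "matpow (0 :: complex^'n^'n) k /\<^sub>R fact k = (if k = 0 then mat 1 else 0)"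
      by (cases k) auto
  qed
  then show ?thesis
    using mexp_sums[of "0 :: complex^'n^'n"] sums_single[of 0 "\<lambda>_. mat 1 :: complex^'n^'n"]
    by (simp only: sums_unique2)
qed

lemma mexp_commute:
  assumes "X ** Y = Y ** X"
  shows "mexp X ** Y = Y ** mexp X"
proof -
  have "(\<lambda>k. (matpow X k /\<^sub>R fact k) ** Y) sums (mexp X ** Y)"
    using bounded_linear.sums[OF matmult.bounded_linear_left mexp_sums] .
  moreover have "(\<lambda>k. Y ** (matpow X k /\<^sub>R fact k)) sums (Y ** mexp X)"
    using bounded_linear.sums[OF matmult.bounded_linear_right mexp_sums] .
  moreover have "(matpow X k /\<^sub>R fact k) ** Y = Y ** (matpow X k /\<^sub>R fact k)" for k
    by (simp add: matmult.scaleR_left matmult.scaleR_right matpow_commute[OF assms])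
  ultimately show ?thesis using sums_unique2 by simp
qed

text \<open>Multiplication by \<open>X\<close> turns the term of index \<open>k\<close> of
  \<open>psi1\<close> into the term of index \<open>Suc k\<close> of \<open>mexp\<close>; only the
  constant term of \<open>mexp\<close> is missing.\<close>

lemma psi1_mult: "X ** psi1 X = mexp X - mat 1"
proof -
  have "(\<lambda>k. X ** (matpow X k /\<^sub>R fact (k + 1))) sums (X ** psi1 X)"
    using bounded_linear.sums[OF matmult.bounded_linear_right psi1_sums] .
  moreover have "X ** (matpow X k /\<^sub>R fact (k + 1)) = matpow X (Suc k) /\<^sub>R fact (Suc k)" for k
    by (simp add: matmult.scaleR_right)
  moreover have "(\<lambda>k. matpow X (Suc k) /\<^sub>R fact (Suc k)) sums (mexp X - mat 1)"
    using sums_Suc_imp mexp_sums[of X] by (subst sums_Suc_iff) simp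
  ultimately show ?thesis using sums_unique2 by simp
qed

lemma psi1_commute:
  assumes "X ** Y = Y ** X"
  shows "psi1 X ** Y = Y ** psi1 X"
proof -
  have "(\<lambda>k. (matpow X k /\<^sub>R fact (k+1)) ** Y) sums (psi1 X ** Y)"
    using bounded_linear.sums[OF matmult.bounded_linear_left psi1_sums] .
  moreover have "(\<lambda>k. Y ** (matpow X k /\<^sub>R fact (k+1))) sums (Y ** psi1 X)"
    using bounded_linear.sums[OF matmult.bounded_linear_right psi1_sums] .
  moreover have "(matpow X k /\<^sub>R fact (k+1)) ** Y = Y ** (matpow X k /\<^sub>R fact (k+1))" for k
    by (simp add: matmult.scaleR_left matmult.scaleR_right matpow_commute[OF assms])
  ultimately show ?thesis using sums_unique2 by simp
qed

lemma continuous_matpow: "continuous_on S (\<lambda>X. matpow X k)"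
proof (induction k)
  case (Suc k)
  then show ?case by (simp add: matmult.continuous_on)
qed simp

text \<open>The partial sums are continuous and converge uniformly on the ball of radius
  \<open>norm X + 1\<close>, which has \<open>X\<close> in its interior.\<close>

lemma isCont_psi1: "isCont psi1 (X :: complex^'n^'n)"
proof -
  define r where "r = norm X + 1"
  obtain M where M: "summable M"
    "\<And>(Z :: complex^'n^'n) k. norm Z \<le> r \<Longrightarrow> norm (matpow Z k /\<^sub>R fact (k + 1)) \<le> M k"
    using matpow_series_bound[of r] by metis
  have "uniform_limit (cball 0 r) (\<lambda>n Z. \<Sum>k<n. matpow Z k /\<^sub>R fact (k + 1))
      (\<lambda>Z :: complex^'n^'n. \<Sum>k. matpow Z k /\<^sub>R fact (k + 1)) sequentially"
    using M by (intro Weierstrass_m_test) auto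
  then have "uniform_limit (cball 0 r) (\<lambda>n Z. \<Sum>k<n. matpow Z k /\<^sub>R fact (k + 1))
      (psi1 :: complex^'n^'n \<Rightarrow> _) sequentially"
    unfolding sums_unique[OF psi1_sums, symmetric] .
  then have "continuous_on (cball 0 r) (psi1 :: complex^'n^'n \<Rightarrow> _)"
    by (rule uniform_limit_theorem[rotated])
      (auto intro!: always_eventually continuous_intros continuous_matpow)
  then show ?thesis
    by (rule continuous_on_interior) (simp add: r_def)
qed

section \<open>Differentiating the exponential along a commuting path\<close>

text \<open>The noncommutative product rule yields one term for each position of \<open>f'\<close>;
  commutation with \<open>f t\<close> moves all of them to the left, where they are equal.\<close>

lemma matpow_has_vector_derivative:
  assumes "(f has_vector_derivative f') (at t within S)" "f' ** f t = f t ** f'"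
  shows "((\<lambda>s. matpow (f s) (Suc k)) has_vector_derivative
           real (Suc k) *\<^sub>R (f' ** matpow (f t) k)) (at t within S)"
proof (induction k)
  case 0
  then show ?case using assms(1) by simp
next
  case (Suc k)
  have "((\<lambda>s. f s ** matpow (f s) (Suc k)) has_vector_derivative
     (f t ** (real (Suc k) *\<^sub>R (f' ** matpow (f t) k)) + f' ** matpow (f t) (Suc k))) (at t within S)"
    by (rule matmult.has_vector_derivative[OF assms(1) Suc])
  moreover have "f t ** (real (Suc k) *\<^sub>R (f' ** matpow (f t) k)) + f' ** matpow (f t) (Suc k)
      = real (Suc (Suc k)) *\<^sub>R (f' ** matpow (f t) (Suc k))"
  proof -
    have "f t ** (f' ** matpow (f t) k) = f' ** matpow (f t) (Suc k)"
      using assms(2) by (simp add: matrix_mul_assoc)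
    then show ?thesis
      unfolding matmult.scaleR_right
      by (simp only: of_nat_Suc[of "Suc k"] scaleR_add_left scaleR_one add.commute)
  qed
  ultimately show ?case by simp
qed

text \<open>Termwise differentiation of the exponential series: on the compact interval both
  \<open>f\<close> and \<open>f'\<close> are bounded, so the differentiated series converges
  uniformly.\<close>

lemma mexp_has_vector_derivative:
  fixes f :: "real \<Rightarrow> complex^'n^'n"
  assumes der: "\<And>t. t \<in> {a..b} \<Longrightarrow> (f has_vector_derivative f' t) (at t within {a..b})"
    and comm: "\<And>t. t \<in> {a..b} \<Longrightarrow> f' t ** f t = f t ** f' t"
    and cont: "continuous_on {a..b} f'"
    and t: "t \<in> {a..b}"
  shows "((\<lambda>t. mexp (f t)) has_vector_derivative f' t ** mexp (f t)) (at t within {a..b})"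
proof -
  define u where "u k s = matpow (f s) k /\<^sub>R fact k" for k s
  \<comment> \<open>\<open>v k\<close> is the derivative of \<open>u k\<close>: the constant term
    contributes 0, and the others reproduce the exponential series shifted by one index.\<close>
  define v where "v k s = (case k of 0 \<Rightarrow> 0 | Suc j \<Rightarrow> f' s ** (matpow (f s) j /\<^sub>R fact j))" for k s
  have contf: "continuous_on {a..b} f"
    using der has_vector_derivative_continuous continuous_on_eq_continuous_within by blast
  obtain r where r: "\<And>s. s \<in> {a..b} \<Longrightarrow> norm (f s) \<le> r"
    using compact_imp_bounded[OF compact_continuous_image[OF contf compact_Icc]]
    unfolding bounded_iff by blast
  obtain r' where r': "\<And>s. s \<in> {a..b} \<Longrightarrow> norm (f' s) \<le> r'"
    using compact_imp_bounded[OF compact_continuous_image[OF cont compact_Icc]]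
    unfolding bounded_iff by blast
  obtain M where M: "summable M"
    "\<And>(Z :: complex^'n^'n) k. norm Z \<le> r \<Longrightarrow> norm (matpow Z k /\<^sub>R fact k) \<le> M k"
    using matpow_series_bound[of r] by metis
  have "\<exists>K>0. \<forall>(X::complex^'n^'n) (Y::complex^'n^'n). norm (X ** Y) \<le> norm X * norm Y * K"
    by (rule matmult.pos_bounded)
  then obtain K where K: "K > 0" "\<And>(X::complex^'n^'n) (Y::complex^'n^'n). norm (X ** Y) \<le> norm X * norm Y * K"
    by auto
  define N where "N k = (case k of 0 \<Rightarrow> 0 | Suc j \<Rightarrow> r' * M j * K)" for k
  have "summable (\<lambda>j. N (Suc j))"
    using M(1) by (auto simp: N_def intro!: summable_mult summable_mult2)
  then have sN: "summable N" by (simp add: summable_Suc_iff)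
  have vN: "norm (v k s) \<le> N k" if "s \<in> {a..b}" for k s
  proof (cases k)
    case (Suc j)
    have "norm (v k s) \<le> norm (f' s) * norm (matpow (f s) j /\<^sub>R fact j) * K"
      unfolding v_def Suc nat.case by (rule K(2))
    also have "\<dots> \<le> r' * M j * K"
      using r'[OF that] M(2)[OF r[OF that], of j] K(1) order_trans[OF norm_ge_zero r'[OF that]]
      by (intro mult_right_mono mult_mono) auto
    finally show ?thesis by (simp add: N_def Suc)
  qed (simp add: v_def N_def)
  have vs: "(\<lambda>k. v k s) sums (f' s ** mexp (f s))" for s
  proof -
    have "(\<lambda>k. v (Suc k) s) sums (f' s ** mexp (f s))"
      unfolding v_def nat.case
      using bounded_linear.sums[OF matmult.bounded_linear_right mexp_sums] .
    then show ?thesis by (subst (asm) sums_Suc_iff) (simp add: v_def)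
  qed
  have "uniform_limit {a..b} (\<lambda>n s. \<Sum>k<n. v k s) (\<lambda>s. \<Sum>k. v k s) sequentially"
    using vN sN by (rule Weierstrass_m_test)
  then have ul: "uniform_limit {a..b} (\<lambda>n s. \<Sum>k<n. v k s) (\<lambda>s. f' s ** mexp (f s)) sequentially"
    using vs by (simp add: sums_iff)
  have "\<exists>g. \<forall>s\<in>{a..b}. (\<lambda>n. u n s) sums (g s) \<and>
      (g has_derivative (\<lambda>h. h *\<^sub>R (f' s ** mexp (f s)))) (at s within {a..b})"
  proof (rule has_derivative_series[where f' = "\<lambda>n s h. h *\<^sub>R v n s"
        and f = u and x = t and l = "mexp (f t)"])
    show "(u n has_derivative (\<lambda>h. h *\<^sub>R v n s)) (at s within {a..b})" if "s \<in> {a..b}" for n s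
    proof (cases n)
      case 0
      then show ?thesis unfolding u_def[abs_def] v_def by simp
    next
      case (Suc k)
      have "((\<lambda>s. matpow (f s) (Suc k) /\<^sub>R fact (Suc k)) has_vector_derivative
           (real (Suc k) *\<^sub>R (f' s ** matpow (f s) k)) /\<^sub>R fact (Suc k)) (at s within {a..b})"
        using matpow_has_vector_derivative[OF der[OF that] comm[OF that]]
        by (intro bounded_linear.has_vector_derivative[OF bounded_linear_scaleR_right])
      moreover have "(real (Suc k) *\<^sub>R (f' s ** matpow (f s) k)) /\<^sub>R fact (Suc k) = v n s"
      proof -
        have "inverse (fact (Suc k)) * real (Suc k) = inverse (fact k :: real)"
          by (simp add: divide_simps)
        then show ?thesis
          unfolding v_def Suc nat.case matmult.scaleR_right scaleR_scaleR by simp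
      qed
      ultimately have "((\<lambda>s. u n s) has_vector_derivative v n s) (at s within {a..b})"
        unfolding u_def Suc by (simp only:)
      then show ?thesis
        unfolding has_vector_derivative_def .
    qed
    show "\<forall>\<^sub>F n in sequentially. \<forall>s\<in>{a..b}. \<forall>h.
       norm ((\<Sum>i<n. h *\<^sub>R v i s) - h *\<^sub>R (f' s ** mexp (f s))) \<le> e * norm h" if "e > 0" for e
      using uniform_limitD[OF ul that]
    proof eventually_elim
      case (elim n)
      show ?case
      proof (intro ballI allI)
        fix s h assume s: "s \<in> {a..b}"
        have "(\<Sum>i<n. h *\<^sub>R v i s) - h *\<^sub>R (f' s ** mexp (f s))
            = h *\<^sub>R ((\<Sum>i<n. v i s) - f' s ** mexp (f s))"
          by (simp only: scaleR_sum_right scaleR_diff_right)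
        then have "norm ((\<Sum>i<n. h *\<^sub>R v i s) - h *\<^sub>R (f' s ** mexp (f s)))
            = \<bar>h\<bar> * dist (\<Sum>i<n. v i s) (f' s ** mexp (f s))"
          by (simp only: dist_norm norm_scaleR)
        also have "\<dots> \<le> \<bar>h\<bar> * e"
          using less_imp_le[OF bspec[OF elim s]] by (rule mult_left_mono) simp
        finally show "norm ((\<Sum>i<n. h *\<^sub>R v i s) - h *\<^sub>R (f' s ** mexp (f s))) \<le> e * norm h"
          by (simp add: mult.commute)
      qed
    qed
    show "(\<lambda>n. u n t) sums mexp (f t)" unfolding u_def by (rule mexp_sums)
  qed (use t in auto)
  then obtain g where g: "\<And>s. s \<in> {a..b} \<Longrightarrow> (\<lambda>n. u n s) sums (g s)"
     "\<And>s. s \<in> {a..b} \<Longrightarrow> (g has_derivative (\<lambda>h. h *\<^sub>R (f' s ** mexp (f s)))) (at s within {a..b})"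
    by blast
  have g_eq: "mexp (f s) = g s" if "s \<in> {a..b}" for s
    using g(1)[OF that] mexp_sums[of "f s"] unfolding u_def by (rule sums_unique2[symmetric])
  show ?thesis
    unfolding has_vector_derivative_def
    by (rule has_derivative_transform[OF t g_eq g(2)[OF t]])
qed

subsection \<open>Exponentials of commuting matrices, injectivity on the principal strip\<close>

text \<open>The product of \<open>mexp (X + t *\<^sub>R Y)\<close> and
  \<open>mexp (t *\<^sub>R (-Y))\<close> has derivative 0 in \<open>t\<close>, so its values at 0
  and 1 agree.\<close>

lemma mexp_add:
  fixes X Y :: "complex^'n^'n"
  assumes "X ** Y = Y ** X"
  shows "mexp (X + Y) = mexp X ** mexp Y"
proof -
  have *: "mexp (X + Y) ** mexp (- Y) = mexp X" if XY: "X ** Y = Y ** X" for X Y :: "complex^'n^'n"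
  proof -
    have d1: "((\<lambda>t. mexp (X + t *\<^sub>R Y)) has_vector_derivative Y ** mexp (X + t *\<^sub>R Y)) (at t within {0..1})"
      if "t \<in> {0..1}" for t
      by (rule mexp_has_vector_derivative[OF _ _ _ that])
        (auto intro!: derivative_eq_intros simp: XY matmult.add_left matmult.add_right
           matmult.scaleR_left matmult.scaleR_right)
    have d2: "((\<lambda>t. mexp (t *\<^sub>R (-Y))) has_vector_derivative (-Y) ** mexp (t *\<^sub>R (-Y))) (at t within {0..1})"
      if "t \<in> {0..1}" for t
      by (rule mexp_has_vector_derivative[OF _ _ _ that])
        (auto intro!: derivative_eq_intros simp: matmult.scaleR_left matmult.scaleR_right
           matmult.minus_left matmult.minus_right)
    have "((\<lambda>t. mexp (X + t *\<^sub>R Y) ** mexp (t *\<^sub>R (-Y))) has_vector_derivative 0) (at t within {0..1})"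
      if t: "t \<in> {0..1}" for t
    proof -
      have c: "mexp (X + t *\<^sub>R Y) ** Y = Y ** mexp (X + t *\<^sub>R Y)"
        by (rule mexp_commute)
          (simp add: XY matmult.add_left matmult.add_right matmult.scaleR_left matmult.scaleR_right)
      have "mexp (X + t *\<^sub>R Y) ** ((-Y) ** mexp (t *\<^sub>R (-Y))) + (Y ** mexp (X + t *\<^sub>R Y)) ** mexp (t *\<^sub>R (-Y)) = 0"
        by (simp add: matmult.minus_left matmult.minus_right matrix_mul_assoc c)
      then show ?thesis
        using matmult.has_vector_derivative[OF d1[OF t] d2[OF t]] by simp
    qed
    then obtain c where c: "\<And>t. t \<in> {0..1::real} \<Longrightarrow> mexp (X + t *\<^sub>R Y) ** mexp (t *\<^sub>R (-Y)) = c"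
      using has_vector_derivative_zero_constant[OF convex_real_interval(5)] by blast
    from c[of 0] c[of 1] show ?thesis by (simp add: mexp_0)
  qed
  \<comment> \<open>The auxiliary identity with 0 in place of \<open>X\<close> supplies the inverse
    by which its general case is then multiplied.\<close>
  have "mexp (-Y) ** mexp Y = mat 1"
    using *[of 0 "-Y"] by (simp add: mexp_0)
  then have "mexp (X + Y) = mexp (X + Y) ** (mexp (- Y) ** mexp Y)"
    by simp
  also have "\<dots> = mexp X ** mexp Y"
    unfolding matrix_mul_assoc *[OF assms] ..
  finally show ?thesis .
qed

lemma mexp_minus: "mexp (- Y) ** mexp Y = mat 1" "mexp Y ** mexp (- Y) = mat 1"
  using mexp_add[of "-Y" Y] mexp_add[of Y "-Y"]
  by (simp_all add: mexp_0 matmult.minus_left matmult.minus_right)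

text \<open>Uniqueness for the linear differential equation Q' = Q f': the product of
  \<open>Q t\<close> and \<open>mexp (- f t)\<close> has derivative 0.\<close>

lemma mexp_path:
  fixes f Q :: "real \<Rightarrow> complex^'n^'n"
  assumes "a \<le> b"
    and der: "\<And>t. t \<in> {a..b} \<Longrightarrow> (f has_vector_derivative f' t) (at t within {a..b})"
    and comm: "\<And>t. t \<in> {a..b} \<Longrightarrow> f' t ** f t = f t ** f' t"
    and cont: "continuous_on {a..b} f'"
    and f0: "f a = 0"
    and derQ: "\<And>t. t \<in> {a..b} \<Longrightarrow> (Q has_vector_derivative Q t ** f' t) (at t within {a..b})"
  shows "Q b = Q a ** mexp (f b)"
proof -
  have "((\<lambda>t. Q t ** mexp (- f t)) has_vector_derivative 0) (at t within {a..b})"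
    if t: "t \<in> {a..b}" for t
  proof -
    have "((\<lambda>t. mexp (- f t)) has_vector_derivative (- f' t) ** mexp (- f t)) (at t within {a..b})"
      by (rule mexp_has_vector_derivative[OF _ _ _ t])
        (auto intro!: has_vector_derivative_minus der continuous_intros cont
          simp: comm matmult.minus_left matmult.minus_right)
    from matmult.has_vector_derivative[OF derQ[OF t] this] show ?thesis
      by (simp add: matmult.minus_left matmult.minus_right matrix_mul_assoc)
  qed
  then obtain c where c: "\<And>t. t \<in> {a..b} \<Longrightarrow> Q t ** mexp (- f t) = c"
    using has_vector_derivative_zero_constant[OF convex_real_interval(5)] by blast
  have "Q b ** mexp (- f b) = Q a"
    using c[of a] c[of b] \<open>a \<le> b\<close> f0 by (simp add: mexp_0)
  then have "Q b ** (mexp (- f b) ** mexp (f b)) = Q a ** mexp (f b)"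
    by (simp add: matrix_mul_assoc)
  then show ?thesis by (simp add: mexp_minus)
qed

lemma bounded_linear_scalar_mult_left: "bounded_linear (\<lambda>c::complex. c *s (v :: complex^'n))"
  by (rule linear_conv_bounded_linear[THEN iffD1])
    (auto intro!: linearI simp: vec_eq_iff algebra_simps)

lemma matpow_eigenvector:
  assumes "X *v v = \<mu> *s v"
  shows "matpow X k *v v = \<mu> ^ k *s v"
  by (induction k) (simp_all add: assms matrix_vector_mul_assoc[symmetric] vec.scale)

lemma mexp_eigenvector:
  fixes X :: "complex^'n^'n"
  assumes "X *v v = \<mu> *s v"
  shows "mexp X *v v = exp \<mu> *s v"
proof -
  have "(\<lambda>k. (matpow X k /\<^sub>R fact k) *v v) sums (mexp X *v v)"
    by (rule bounded_linear.sums[OF matvec.bounded_linear_left mexp_sums])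
  moreover have "(\<lambda>k. (\<mu> ^ k /\<^sub>R fact k) *s v) sums (exp \<mu> *s v)"
    by (rule bounded_linear.sums[OF bounded_linear_scalar_mult_left exp_converges])
  moreover have "(matpow X k /\<^sub>R fact k) *v v = (\<mu> ^ k /\<^sub>R fact k) *s v" for k
    by (simp add: matvec.scaleR_left matpow_eigenvector[OF assms] vec_eq_iff)
  ultimately show ?thesis using sums_unique2 by simp
qed

lemma psi1_kernel:
  fixes X :: "complex^'n^'n"
  assumes "X *v v = 0"
  shows "psi1 X *v v = v"
proof -
  have "(\<lambda>k. (matpow X k /\<^sub>R fact (k + 1)) *v v) sums (psi1 X *v v)"
    by (rule bounded_linear.sums[OF matvec.bounded_linear_left psi1_sums])
  moreover have "(matpow X k /\<^sub>R fact (k + 1)) *v v = (if k = 0 then v else 0)" for k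
    using matpow_eigenvector[of X v 0 k] assms by (simp add: matvec.scaleR_left)
  ultimately show ?thesis
    using sums_single[of 0 "\<lambda>_. v"] sums_unique2 by simp
qed

section \<open>Eigenvectors inside invariant subspaces\<close>

text \<open>Among \<open>CARD('n) + 1\<close> vectors there is a linear relation. The sequence is
  arbitrary so that it can be a Krylov sequence or the flattened powers of a matrix. Repeated
  vectors form a separate case, since dependence is a property of sets.\<close>

lemma exists_annihilating_poly:
  fixes w :: "nat \<Rightarrow> complex^'n"
  shows "\<exists>p :: complex poly. p \<noteq> 0 \<and> (\<Sum>i\<le>degree p. coeff p i *s w i) = 0"
proof (cases "inj_on w {..CARD('n)}")
  case True
  let ?S = "w ` {..CARD('n)}"
  have "vec.dependent ?S"
  proof (rule ccontr)
    assume "\<not> vec.dependent ?S"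
    then have "card ?S \<le> vec.dim (UNIV :: (complex^'n) set)"
      by (intro vec.independent_card_le_dim) auto
    then show False
      by (simp add: card_image True vec_dim_card del: vec.dim_UNIV)
  qed
  then obtain u v where u: "v \<in> ?S" "u v \<noteq> 0" "(\<Sum>v\<in>?S. u v *s v) = 0"
    using vec.dependent_finite[of ?S] by auto
  define p where "p = (\<Sum>i\<le>CARD('n). monom (u (w i)) i)"
  have cp: "coeff p i = (if i \<le> CARD('n) then u (w i) else 0)" for i
    by (simp add: p_def coeff_sum coeff_monom sum.delta)
  have dp: "degree p \<le> CARD('n)"
    by (rule degree_le) (simp add: cp)
  have "(\<Sum>i\<le>degree p. coeff p i *s w i) = (\<Sum>i\<le>CARD('n). coeff p i *s w i)"
    using dp by (intro sum.mono_neutral_left) (auto simp: coeff_eq_0)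
  also have "\<dots> = (\<Sum>v\<in>?S. u v *s v)"
    by (simp add: sum.reindex[OF True] cp)
  finally have "(\<Sum>i\<le>degree p. coeff p i *s w i) = 0" using u(3) by simp
  moreover have "p \<noteq> 0" using u(1,2) cp by (metis (no_types, lifting) atMost_iff coeff_0 imageE)
  ultimately show ?thesis by blast
next
  case False
  then obtain i j where ij: "i < j" "w i = w j"
    by (metis inj_onI linorder_neqE_nat)
  define p where "p = monom 1 j - (monom 1 i :: complex poly)"
  have cp: "coeff p k = (if k = j then 1 else if k = i then -1 else 0)" for k
    using ij(1) by (auto simp: p_def coeff_monom)
  have "degree p \<le> j"
    by (rule degree_le) (use ij(1) in \<open>auto simp: cp\<close>)
  then have dp: "degree p = j"
    using le_degree[of p j] by (simp add: cp)
  have "(\<Sum>k\<le>j. coeff p k *s w k) = (\<Sum>k\<in>{i, j}. coeff p k *s w k)"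
    using ij by (intro sum.mono_neutral_right) (auto simp: cp)
  also have "\<dots> = 0"
    using ij by (simp add: cp vec_eq_iff)
  finally have "(\<Sum>k\<le>degree p. coeff p k *s w k) = 0" by (simp add: dp)
  moreover have "p \<noteq> 0" using cp[of j] by auto
  ultimately show ?thesis by blast
qed

text \<open>Take a polynomial \<open>p\<close> of least degree annihilating the Krylov sequence of
  \<open>v\<close>, a root \<mu>, and p = (x - \<mu>) q. By minimality \<open>ev q\<close> is
  nonzero, and it is an eigenvector. Restricting to an invariant \<open>V\<close> makes common
  eigenvectors of commuting matrices available.\<close>

lemma exists_eigenvector:
  fixes T :: "complex^'n^'n"
  assumes V: "vec.subspace V" and inv: "\<And>x. x \<in> V \<Longrightarrow> T *v x \<in> V"
    and v: "v \<in> V" "v \<noteq> 0"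
  shows "\<exists>x \<mu>. x \<in> V \<and> x \<noteq> 0 \<and> T *v x = \<mu> *s x"
proof -
  define w where "w i = matpow T i *v v" for i
  define ev where "ev p = (\<Sum>i\<le>degree p. coeff p i *s w i)" for p :: "complex poly"
  have wV: "w i \<in> V" for i
    unfolding w_def by (induction i) (auto simp: v inv matrix_vector_mul_assoc[symmetric])
  have evV: "ev p \<in> V" for p
    unfolding ev_def by (intro vec.subspace_sum[OF V] vec.subspace_scale[OF V] wV)
  define p where "p = (ARG_MIN degree p. p \<noteq> 0 \<and> ev p = 0)"
  obtain p' where p': "p' \<noteq> 0 \<and> ev p' = 0"
    using exists_annihilating_poly[of w] by (auto simp: ev_def)
  have p: "p \<noteq> 0" "ev p = 0"
    using arg_min_nat_lemma[of "\<lambda>p. p \<noteq> 0 \<and> ev p = 0" p' degree, OF p']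
    by (auto simp: p_def)
  have p_min: "degree p \<le> degree q" if "q \<noteq> 0" "ev q = 0" for q
    using arg_min_nat_lemma[of "\<lambda>p. p \<noteq> 0 \<and> ev p = 0" p' degree, OF p'] that
    by (auto simp: p_def)
  have "degree p \<noteq> 0"
  proof
    assume "degree p = 0"
    then have "coeff p 0 *s v = 0" using p(2) by (simp add: ev_def w_def)
    moreover have "coeff p 0 \<noteq> 0"
      using p(1) \<open>degree p = 0\<close> by (metis leading_coeff_0_iff)
    ultimately show False using v(2) by (simp add: vec_eq_iff)
  qed
  then have "\<not> constant (poly p)" by (simp add: constant_degree)
  then obtain \<mu> where "poly p \<mu> = 0" using fundamental_theorem_of_algebra by blast
  then obtain q where q: "p = [:-\<mu>, 1:] * q" by (metis dvdE poly_eq_0_iff_dvd)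
  have "q \<noteq> 0" using p(1) unfolding q by (metis mult_zero_right)
  then have dq: "degree p = Suc (degree q)"
    unfolding q by (subst degree_mult_eq) auto
  have cp: "coeff p i = (case i of 0 \<Rightarrow> 0 | Suc j \<Rightarrow> coeff q j) - \<mu> * coeff q i" for i
    by (simp add: q coeff_pCons split: nat.split)
  \<comment> \<open>Multiplying a polynomial by x shifts its coefficients, which on the Krylov
    sequence is an application of \<open>T\<close>; hence \<open>ev p\<close> is (T - \<mu> I)
    applied to \<open>ev q\<close>.\<close>
  have "ev p = (\<Sum>i\<le>Suc (degree q). (case i of 0 \<Rightarrow> 0 | Suc j \<Rightarrow> coeff q j) *s w i)
      - (\<Sum>i\<le>Suc (degree q). (\<mu> * coeff q i) *s w i)"
    unfolding ev_def dq cp by (simp add: vec.scale_left_diff_distrib sum_subtractf del: sum.atMost_Suc)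
  also have "(\<Sum>i\<le>Suc (degree q). (case i of 0 \<Rightarrow> 0 | Suc j \<Rightarrow> coeff q j) *s w i)
      = (\<Sum>i\<le>degree q. coeff q i *s w (Suc i))"
    by (subst sum.atMost_Suc_shift) simp
  also have "\<dots> = T *v ev q"
    by (simp add: ev_def w_def matvec.sum_right vec.scale matrix_vector_mul_assoc)
  also have "(\<Sum>i\<le>Suc (degree q). (\<mu> * coeff q i) *s w i) = \<mu> *s ev q"
    by (simp add: ev_def vec.scale_sum_right coeff_eq_0)
  finally have "T *v ev q = \<mu> *s ev q" using p(2) by simp
  moreover have "ev q \<noteq> 0" using p_min[OF \<open>q \<noteq> 0\<close>] dq by auto
  ultimately show ?thesis using evV by blast
qed

lemma eigenspace_subspace: "vec.subspace {v :: complex^'n. T *v v = \<mu> *s v}"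
  unfolding vec.subspace_def by (auto simp: vec.add vec.scale vec.scale_right_distrib mult.commute)

lemma eigenspace_invariant:
  fixes X T :: "complex^'n^'n"
  assumes "X ** T = T ** X" "T *v v = \<mu> *s v"
  shows "T *v (X *v v) = \<mu> *s (X *v v)"
proof -
  have "T *v (X *v v) = X *v (T *v v)"
    by (simp add: matrix_vector_mul_assoc assms(1))
  then show ?thesis by (simp add: assms(2) vec.scale)
qed

lemma mat_eigenvalue_iff: "mat_eigenvalue X \<mu> \<longleftrightarrow> (\<exists>v. v \<noteq> 0 \<and> X *v v = \<mu> *s v)"
  by (simp add: mat_eigenvalue_def vector_scalar_mult_def)

section \<open>Uniqueness of the logarithm in the principal strip\<close>

text \<open>The spectral condition in \<open>mlog\<close>, named so that the definite description
  can be folded.\<close>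

definition log_strip :: "complex^'n^'n \<Rightarrow> bool" where
  "log_strip X \<longleftrightarrow> (\<forall>\<mu>. mat_eigenvalue X \<mu> \<longrightarrow> - pi < Im \<mu> \<and> Im \<mu> < pi)"

lemma matrix_kernel_trivial_imp_invertible:
  fixes X :: "complex^'n^'n"
  assumes "\<And>v. X *v v = 0 \<Longrightarrow> v = 0"
  shows "invertible X"
  using assms unfolding invertible_left_inverse matrix_left_invertible_ker by blast

text \<open>The kernel of \<open>psi1 N\<close> is invariant under \<open>N\<close>, so if
  nontrivial it contains an eigenvector of \<open>N\<close>, necessarily for the eigenvalue 0. But
  on the kernel of \<open>N\<close> the matrix \<open>psi1 N\<close> is the identity.\<close>

lemma invertible_psi1_nilpotent:
  fixes N :: "complex^'n^'n"
  assumes "\<And>\<mu>. mat_eigenvalue N \<mu> \<Longrightarrow> \<mu> = 0"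
  shows "invertible (psi1 N)"
proof (rule matrix_kernel_trivial_imp_invertible, rule ccontr)
  fix v assume v: "psi1 N *v v = 0" "v \<noteq> 0"
  let ?V = "{v. psi1 N *v v = 0 *s v}"
  have "N *v x \<in> ?V" if "x \<in> ?V" for x
    using eigenspace_invariant[of N "psi1 N" x 0] that psi1_commute[of N N] by simp
  then obtain x \<mu> where x: "psi1 N *v x = 0" "x \<noteq> 0" "N *v x = \<mu> *s x"
    using exists_eigenvector[OF eigenspace_subspace[of "psi1 N" 0], of N v] v by auto
  then have "\<mu> = 0" using assms mat_eigenvalue_iff by blast
  with x show False using psi1_kernel[of N x] by simp
qed

text \<open>The difference \<open>N\<close> has exponential \<open>mat 1\<close>. A common
  eigenvector of \<open>N\<close>, \<open>X\<close> and \<open>Z\<close> shows that an eigenvalue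
  \<mu> of \<open>N\<close> has exp \<mu> = 1 and imaginary part below 2 pi in modulus, so \<mu> =
  0. Then \<open>psi1 N\<close> is invertible, and \<open>N ** psi1 N = 0\<close> forces
  \<open>N = 0\<close>.\<close>

lemma mexp_inj_log_strip:
  fixes X Z :: "complex^'n^'n"
  assumes comm: "X ** Z = Z ** X" and eq: "mexp X = mexp Z"
    and strip: "log_strip X" "log_strip Z"
  shows "X = Z"
proof -
  define N where "N = X - Z"
  have "mexp N = mexp X ** mexp (- Z)"
    unfolding N_def using mexp_add[of X "-Z"] comm
    by (simp add: matmult.minus_left matmult.minus_right)
  then have N1: "mexp N = mat 1" by (simp add: eq mexp_minus)
  have "\<mu> = 0" if eig: "mat_eigenvalue N \<mu>" for \<mu>
  proof -
    let ?V = "{v. N *v v = \<mu> *s v}"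
    obtain v where v: "v \<noteq> 0" "v \<in> ?V" using eig by (auto simp: mat_eigenvalue_iff)
    have "X ** N = N ** X" by (simp add: N_def matmult.diff_left matmult.diff_right comm)
    then have "X *v x \<in> ?V" if "x \<in> ?V" for x
      using eigenspace_invariant that by blast
    then obtain x \<xi> where x: "N *v x = \<mu> *s x" "x \<noteq> 0" "X *v x = \<xi> *s x"
      using exists_eigenvector[OF eigenspace_subspace[of N \<mu>], of X v] v by auto
    have "Z *v x = X *v x - N *v x" by (simp add: N_def matvec.diff_left)
    then have "Z *v x = (\<xi> - \<mu>) *s x" by (simp add: x vec.scale_left_diff_distrib)
    then have "-pi < Im \<xi>" "Im \<xi> < pi" "-pi < Im (\<xi> - \<mu>)" "Im (\<xi> - \<mu>) < pi"
      using strip x(2,3) unfolding log_strip_def mat_eigenvalue_iff by blast+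
    then have "\<bar>Im \<mu>\<bar> < 2 * pi" by auto
    moreover have "exp \<mu> *s x = 1 *s x"
      using mexp_eigenvector[OF x(1)] by (simp add: N1)
    then have "exp \<mu> = 1" using x(2) by (simp only: vec.scale_cancel_right) simp
    then have "\<mu> = 0" if "\<bar>Im \<mu>\<bar> < 2 * pi"
      using that exp_complex_eqI[of \<mu> 0] by (simp add: dist_norm)
    ultimately show ?thesis by blast
  qed
  then have "invertible (psi1 N)" by (rule invertible_psi1_nilpotent)
  then obtain B where "psi1 N ** B = mat 1" unfolding invertible_def by blast
  moreover have "N ** psi1 N = 0" by (simp add: psi1_mult N1)
  ultimately have "N ** mat 1 = 0 ** B"
    by (metis matrix_mul_assoc)
  then have "N = 0" by simp
  then show ?thesis by (simp add: N_def)
qed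

subsection \<open>The scalar pencil on an arc\<close>

lemma matrix_inv_mult:
  fixes A :: "'a::semiring_1^'n^'m"
  assumes "invertible A"
  shows "A ** matrix_inv A = mat 1" "matrix_inv A ** A = mat 1"
  using assms someI_ex[of "\<lambda>A'. A ** A' = mat 1 \<and> A' ** A = mat 1"]
  unfolding invertible_def matrix_inv_def by blast+

lemma matrix_inv_unique_right:
  fixes A B :: "complex^'n^'n"
  assumes "A ** B = mat 1"
  shows "matrix_inv A = B" "invertible A"
proof -
  show inv: "invertible A" using assms invertible_right_inverse by blast
  have "matrix_inv A = matrix_inv A ** (A ** B)" by (simp add: assms)
  also have "\<dots> = B" by (simp add: matrix_mul_assoc matrix_inv_mult[OF inv])
  finally show "matrix_inv A = B" .
qed

lemma matrix_inv_commute: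
  fixes A C :: "complex^'n^'n"
  assumes "invertible A" "A ** C = C ** A"
  shows "matrix_inv A ** C = C ** matrix_inv A"
proof -
  have "matrix_inv A ** C = matrix_inv A ** (C ** A) ** matrix_inv A"
    by (simp add: matrix_inv_mult[OF assms(1)] flip: matrix_mul_assoc)
  also have "\<dots> = matrix_inv A ** A ** C ** matrix_inv A"
    by (simp add: assms(2) matrix_mul_assoc flip: assms(2))
  also have "\<dots> = C ** matrix_inv A"
    by (simp add: matrix_inv_mult[OF assms(1)])
  finally show ?thesis .
qed

text \<open>By Cramer's rule each entry of the inverse is a quotient of determinants, which are
  polynomials in the entries, with nonzero denominator.\<close>

lemma continuous_on_matrix_inv:
  fixes f :: "'a::topological_space \<Rightarrow> complex^'n^'n"
  assumes cont: "continuous_on S f" and inv: "\<And>x. x \<in> S \<Longrightarrow> invertible (f x)"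
  shows "continuous_on S (\<lambda>x. matrix_inv (f x))"
proof -
  have contdet: "continuous_on S (\<lambda>x. det (\<chi> i j. (h x i j :: complex)))"
    if "\<And>i j. continuous_on S (\<lambda>x. h x i j)" for h :: "'a \<Rightarrow> 'n \<Rightarrow> 'n \<Rightarrow> complex"
    unfolding det_def by (auto intro!: continuous_intros that)
  have cf: "continuous_on S (\<lambda>x. f x $ i $ j)" for i j
    using cont by (intro continuous_intros)
  have cdet: "continuous_on S (\<lambda>x. det (f x))"
    using contdet[of "\<lambda>x i j. f x $ i $ j"] cf by simp
  have "matrix_inv (f x) = (\<chi> k m. det (\<chi> i j. if j = k then axis m 1 $ i else f x $ i $ j) / det (f x))"
    if x: "x \<in> S" for x
  proof -
    have d: "det (f x) \<noteq> 0" using inv[OF x] by (simp add: invertible_det_nz)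
    have "f x *v column m (matrix_inv (f x)) = axis m 1" for m
    proof -
      have "f x *v column m (matrix_inv (f x)) = column m (f x ** matrix_inv (f x))"
        by (simp add: vec_eq_iff column_def matrix_vector_mult_def matrix_matrix_mult_def)
      then show ?thesis
        by (simp add: matrix_inv_mult[OF inv[OF x]] vec_eq_iff column_def mat_def axis_def)
    qed
    then have "column m (matrix_inv (f x)) = (\<chi> k. det (\<chi> i j. if j = k then axis m 1 $ i else f x $ i $ j) / det (f x))" for m
      using cramer[OF d] by blast
    then show ?thesis
      by (simp add: vec_eq_iff column_def)
  qed
  moreover have "continuous_on S (\<lambda>x. \<chi> k m. det (\<chi> i j. if j = k then axis m 1 $ i else f x $ i $ j) / det (f x))"
  proof (intro continuous_on_vec_lambda continuous_on_divide contdet cdet ballI)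
    show "continuous_on S (\<lambda>x. if j = k then axis m 1 $ i else f x $ i $ j)" for i j k m
      by (cases "j = k") (simp_all add: cf)
    show "det (f x) \<noteq> 0" if "x \<in> S" for x
      using inv[OF that] by (simp add: invertible_det_nz)
  qed
  ultimately show ?thesis by (subst continuous_on_cong[OF refl])
qed

section \<open>Scalar logarithms along the arc\<close>

text \<open>Both numbers are, up to the factor -\<i> or \<i>, a unit number at half angle divided by
  \<open>cos (\<theta> / 2)\<close>, and the cosine is positive on the open interval. This
  translates between tangents and exponentials.\<close>

lemma tan_half_cis:
  assumes "-pi < \<theta>" "\<theta> < pi"
  shows "complex_of_real (tan (\<theta> / 2)) + \<i> = - (cis (- \<theta>) * (complex_of_real (tan (\<theta> / 2)) - \<i>))"
    "cis \<theta> * (complex_of_real (tan (\<theta> / 2)) + \<i>) = - (complex_of_real (tan (\<theta> / 2)) - \<i>)"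
    "complex_of_real (tan (\<theta> / 2)) - \<i> \<noteq> 0"
    "complex_of_real (tan (\<theta> / 2)) + \<i> \<noteq> 0"
proof -
  have c: "cos (\<theta> / 2) \<noteq> 0"
    using cos_gt_zero_pi[of "\<theta> / 2"] assms by simp
  have m: "complex_of_real (tan (\<theta> / 2)) - \<i> = - \<i> * cis (\<theta> / 2) / cos (\<theta> / 2)"
    and p: "complex_of_real (tan (\<theta> / 2)) + \<i> = \<i> * cis (- \<theta> / 2) / cos (\<theta> / 2)"
    using c by (auto simp: complex_eq_iff tan_def Re_divide_of_real Im_divide_of_real)
  have "cis (- \<theta> / 2) = cis (- \<theta>) * cis (\<theta> / 2)" "cis \<theta> * cis (- \<theta> / 2) = cis (\<theta> / 2)"
    by (simp_all add: cis_mult)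
  then show "complex_of_real (tan (\<theta> / 2)) + \<i> = - (cis (- \<theta>) * (complex_of_real (tan (\<theta> / 2)) - \<i>))"
    "cis \<theta> * (complex_of_real (tan (\<theta> / 2)) + \<i>) = - (complex_of_real (tan (\<theta> / 2)) - \<i>)"
    unfolding m p by (auto simp: mult_ac)
  show "complex_of_real (tan (\<theta> / 2)) - \<i> \<noteq> 0" "complex_of_real (tan (\<theta> / 2)) + \<i> \<noteq> 0"
    by (auto simp: complex_eq_iff)
qed

text \<open>The eigenvalue of \<Gamma> times the inverse of \<open>W\<close> on a common
  eigenvector. It is affine in the half-angle tangent, so an arc is sent into a segment.\<close>

definition cayley_line :: "complex \<Rightarrow> complex \<Rightarrow> real \<Rightarrow> complex" where
  "cayley_line f g \<theta> = (complex_of_real (tan (\<theta> / 2)) - \<i>) * f + (complex_of_real (tan (\<theta> / 2)) + \<i>) * g"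

lemma cayley_line_eq:
  assumes "-pi < \<theta>" "\<theta> < pi"
  shows "cayley_line f g \<theta> = - ((complex_of_real (tan (\<theta> / 2)) + \<i>) * (cis \<theta> * f - g))"
proof -
  have *: "complex_of_real (tan (\<theta> / 2)) - \<i> = - (cis \<theta> * (complex_of_real (tan (\<theta> / 2)) + \<i>))"
    using tan_half_cis(2)[OF assms] by simp
  show ?thesis unfolding cayley_line_def * by (simp add: algebra_simps)
qed

lemma cayley_line_nonzero:
  assumes "-pi < \<theta>" "\<theta> < pi" "cis \<theta> * f \<noteq> g"
  shows "cayley_line f g \<theta> \<noteq> 0"
  using assms tan_half_cis(4)[OF assms(1,2)] by (simp add: cayley_line_eq)

text \<open>A quotient \<open>- r\<close> with \<open>r \<ge> 0\<close> would make a convex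
  combination of the two endpoint values vanish. By affinity in the tangent, this combination is the
  value at an intermediate angle, where the line is nonzero.\<close>

lemma cayley_line_quotient:
  assumes "-pi < a" "a \<le> b" "b < pi" and nz: "\<And>\<theta>. \<theta> \<in> {a..b} \<Longrightarrow> cis \<theta> * f \<noteq> g"
  shows "cayley_line f g b / cayley_line f g a \<notin> \<real>\<^sub>\<le>\<^sub>0"
proof
  assume "cayley_line f g b / cayley_line f g a \<in> \<real>\<^sub>\<le>\<^sub>0"
  then obtain r where "r \<le> 0" "cayley_line f g b / cayley_line f g a = complex_of_real r"
    by (auto elim!: nonpos_Reals_cases)
  then obtain r where r: "r \<ge> 0" "cayley_line f g b / cayley_line f g a = complex_of_real (- r)"
    by (metis add.inverse_inverse neg_0_le_iff_le)
  have "cayley_line f g a \<noteq> 0" using assms by (intro cayley_line_nonzero) auto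
  with r have eq: "cayley_line f g b + complex_of_real r * cayley_line f g a = 0"
    by (simp add: field_simps)
  \<comment> \<open>The mean of the endpoint tangents with weights 1 and \<open>r\<close>; the
    intermediate angle is \<open>2 * arctan \<tau>\<close>.\<close>
  define \<tau> where "\<tau> = (tan (b / 2) + r * tan (a / 2)) / (1 + r)"
  have tan_le: "tan (a / 2) \<le> tan (b / 2)"
    using assms tan_mono_le[of "a/2" "b/2"] by simp
  have "\<tau> * (1 + r) = tan (b / 2) + r * tan (a / 2)" using r(1) by (simp add: \<tau>_def)
  have "tan (a / 2) \<le> \<tau>" "\<tau> \<le> tan (b / 2)"
    using r(1) tan_le mult_left_mono[OF tan_le r(1)] by (auto simp: \<tau>_def field_simps)
  then have "arctan (tan (a / 2)) \<le> arctan \<tau>" "arctan \<tau> \<le> arctan (tan (b / 2))"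
    by (simp_all add: arctan_le_iff)
  then have \<phi>: "2 * arctan \<tau> \<in> {a..b}"
    using assms by (simp add: arctan_tan)
  have "complex_of_real (1 + r) * cayley_line f g (2 * arctan \<tau>) =
      (complex_of_real (\<tau> * (1 + r)) - \<i> * (1 + r)) * f + (complex_of_real (\<tau> * (1 + r)) + \<i> * (1 + r)) * g"
    unfolding cayley_line_def by (simp add: tan_arctan algebra_simps)
  also have "\<dots> = cayley_line f g b + complex_of_real r * cayley_line f g a"
    unfolding \<open>\<tau> * (1 + r) = _\<close> cayley_line_def by (simp add: algebra_simps)
  also have "\<dots> = 0" by (rule eq)
  finally have "cayley_line f g (2 * arctan \<tau>) = 0"
    using r(1) by (auto simp: complex_eq_iff)
  moreover have "cayley_line f g (2 * arctan \<tau>) \<noteq> 0"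
    using \<phi> assms by (intro cayley_line_nonzero nz) auto
  ultimately show False by simp
qed

text \<open>Dividing by the value at \<open>a\<close> keeps the argument of \<open>Ln\<close> off
  its branch cut along the whole arc, by \<open>cayley_line_quotient\<close> on the arc from
  \<open>a\<close> to \<theta>. The numerator comes from the derivative of the half-angle
  tangent.\<close>

lemma Ln_cayley_line_has_vector_derivative:
  assumes "-pi < a" "b < pi" and nz: "\<And>\<theta>. \<theta> \<in> {a..b} \<Longrightarrow> cis \<theta> * f \<noteq> g"
    and \<theta>: "\<theta> \<in> {a..b}"
  shows "((\<lambda>\<theta>. Ln (cayley_line f g \<theta> / cayley_line f g a)) has_vector_derivative
    ((1 + complex_of_real (tan (\<theta> / 2)) ^ 2) / 2 * (f + g)) / cayley_line f g \<theta>) (at \<theta> within {a..b})"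
proof -
  have nz0: "cayley_line f g a \<noteq> 0" "cayley_line f g \<theta> \<noteq> 0"
    using assms by (intro cayley_line_nonzero nz; auto)+
  have c: "cos (\<theta> / 2) \<noteq> 0"
    using cos_gt_zero_pi[of "\<theta> / 2"] assms by simp
  have "((\<lambda>\<theta>. tan (\<theta> / 2)) has_real_derivative (1 + tan (\<theta> / 2) ^ 2) / 2) (at \<theta> within {a..b})"
  proof -
    have "inverse ((cos (\<theta> / 2))\<^sup>2) = 1 + tan (\<theta> / 2) ^ 2"
      using tan_sec[OF c] by (simp add: power_inverse)
    moreover have "((\<lambda>\<theta>. tan (\<theta> / 2)) has_real_derivative inverse ((cos (\<theta> / 2))\<^sup>2) * (1 / 2)) (at \<theta> within {a..b})"
      by (rule DERIV_chain'[where f = "\<lambda>\<theta>. \<theta> / 2" and g = tan, OF _ DERIV_tan[OF c]])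
        (auto intro!: derivative_eq_intros)
    ultimately show ?thesis by simp
  qed
  then have "((\<lambda>\<theta>. complex_of_real (tan (\<theta> / 2))) has_vector_derivative
      complex_of_real ((1 + tan (\<theta> / 2) ^ 2) / 2)) (at \<theta> within {a..b})"
    by (intro has_vector_derivative_of_real) (simp add: has_real_derivative_iff_has_vector_derivative)
  from has_vector_derivative_diff[OF
      has_vector_derivative_mult_left[OF this, of "(f + g) / cayley_line f g a"]
      has_vector_derivative_const[of "\<i> * (f - g) / cayley_line f g a"]]
  have "((\<lambda>\<theta>. complex_of_real (tan (\<theta> / 2)) * ((f + g) / cayley_line f g a) - \<i> * (f - g) / cayley_line f g a)
      has_vector_derivative ((1 + complex_of_real (tan (\<theta> / 2)) ^ 2) / 2 * (f + g)) / cayley_line f g a)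
      (at \<theta> within {a..b})"
    by simp
  moreover have "complex_of_real (tan (x / 2)) * ((f + g) / cayley_line f g a) - \<i> * (f - g) / cayley_line f g a
      = cayley_line f g x / cayley_line f g a" for x
    unfolding cayley_line_def[of _ _ x] times_divide_eq_right diff_divide_distrib[symmetric]
    by (simp add: algebra_simps)
  ultimately have "((\<lambda>\<theta>. cayley_line f g \<theta> / cayley_line f g a) has_vector_derivative
     ((1 + complex_of_real (tan (\<theta> / 2)) ^ 2) / 2 * (f + g)) / cayley_line f g a) (at \<theta> within {a..b})"
    by (simp only:)
  moreover have "(Ln has_field_derivative inverse (cayley_line f g \<theta> / cayley_line f g a))
     (at (cayley_line f g \<theta> / cayley_line f g a) within ((\<lambda>\<theta>. cayley_line f g \<theta> / cayley_line f g a) ` {a..b}))"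
    using assms by (intro has_field_derivative_Ln has_field_derivative_at_within cayley_line_quotient) auto
  ultimately have "(Ln \<circ> (\<lambda>\<theta>. cayley_line f g \<theta> / cayley_line f g a) has_vector_derivative
     ((1 + complex_of_real (tan (\<theta> / 2)) ^ 2) / 2 * (f + g)) / cayley_line f g a *
     inverse (cayley_line f g \<theta> / cayley_line f g a)) (at \<theta> within {a..b})"
    by (rule field_vector_diff_chain_within)
  then show ?thesis using nz0 by (simp add: o_def divide_simps)
qed

text \<open>The difference of the two logarithms is a primitive that vanishes at \<open>a\<close>.
  The line with parameters 1 and 0 is t - \<i>, so the subtracted logarithm is the scalar \<eta> of
  the theorem.\<close>

lemma cis_pencil_integral:
  assumes "-pi < a" "a \<le> b" "b < pi" and nz: "\<And>\<theta>. \<theta> \<in> {a..b} \<Longrightarrow> cis \<theta> * f \<noteq> g"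
  shows "((\<lambda>\<theta>. \<i> * g / (cis \<theta> * f - g)) has_integral
     (Ln (cayley_line f g b / cayley_line f g a) - Ln (cayley_line 1 0 b / cayley_line 1 0 a))) {a..b}"
proof -
  let ?h = "\<lambda>\<theta>. Ln (cayley_line f g \<theta> / cayley_line f g a) - Ln (cayley_line 1 0 \<theta> / cayley_line 1 0 a)"
  have "(?h has_vector_derivative \<i> * g / (cis \<theta> * f - g)) (at \<theta> within {a..b})" if \<theta>: "\<theta> \<in> {a..b}" for \<theta>
  proof -
    define t where "t = complex_of_real (tan (\<theta> / 2))"
    have b: "-pi < \<theta>" "\<theta> < pi" using \<theta> assms by auto
    have cl: "cayley_line f g \<theta> = - ((t + \<i>) * (cis \<theta> * f - g))"
      "cayley_line 1 0 \<theta> = t - \<i>"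
      using cayley_line_eq[OF b] by (auto simp: t_def cayley_line_def)
    have t: "t - \<i> \<noteq> 0" "t + \<i> \<noteq> 0" "cis \<theta> = - (t - \<i>) / (t + \<i>)"
      using tan_half_cis[OF b] by (auto simp: t_def field_simps)
    have c: "cayley_line f g \<theta> \<noteq> 0" "cis \<theta> * f - g \<noteq> 0"
      using nz[OF \<theta>] cayley_line_nonzero[OF b] by auto
    \<comment> \<open>One factor cancels against the second line, the other against the factor in
      \<open>cayley_line_eq\<close>; this turns tangents back into
      \<open>cis \<theta>\<close>.\<close>
    have fac: "1 + t ^ 2 = (t - \<i>) * (t + \<i>)" by (simp add: algebra_simps power2_eq_square)
    have cl': "cayley_line f g \<theta> = (t - \<i>) * f + (t + \<i>) * g" by (simp add: t_def cayley_line_def)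
    have "(1 + t ^ 2) / 2 * (f + g) / cayley_line f g \<theta> - (1 + t ^ 2) / 2 * (1 + 0) / cayley_line 1 0 \<theta>
      = (t + \<i>) / 2 * ((t - \<i>) * (f + g) - cayley_line f g \<theta>) / cayley_line f g \<theta>"
      unfolding fac cl(2) using c(1) t(1) by (simp add: divide_simps) (simp add: algebra_simps)
    also have "(t - \<i>) * (f + g) - cayley_line f g \<theta> = - 2 * \<i> * g"
      unfolding cl' by (simp add: algebra_simps)
    also have "(t + \<i>) / 2 * (- 2 * \<i> * g) / cayley_line f g \<theta> = \<i> * g / (cis \<theta> * f - g)"
      unfolding cl(1) using c(2) t(2) by (simp add: divide_simps)
    finally have "(1 + t ^ 2) / 2 * (f + g) / cayley_line f g \<theta> - (1 + t ^ 2) / 2 * (1 + 0) / cayley_line 1 0 \<theta>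
        = \<i> * g / (cis \<theta> * f - g)" .
    moreover have "(?h has_vector_derivative
       (1 + t ^ 2) / 2 * (f + g) / cayley_line f g \<theta> - (1 + t ^ 2) / 2 * (1 + 0) / cayley_line 1 0 \<theta>) (at \<theta> within {a..b})"
      unfolding t_def using assms \<theta>
      by (intro has_vector_derivative_diff Ln_cayley_line_has_vector_derivative) auto
    ultimately show ?thesis by simp
  qed
  then have "((\<lambda>\<theta>. \<i> * g / (cis \<theta> * f - g)) has_integral (?h b - ?h a)) {a..b}"
    using \<open>a \<le> b\<close> by (intro fundamental_theorem_of_calculus) auto
  moreover have "?h a = 0"
    using cayley_line_nonzero[of a f g] cayley_line_nonzero[of a 1 0] assms by simp
  ultimately show ?thesis by simp
qed

lemma Im_Ln_bounds:
  assumes "z \<notin> \<real>\<^sub>\<le>\<^sub>0"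
  shows "- pi < Im (Ln z)" "Im (Ln z) < pi"
proof -
  have "z \<noteq> 0" using assms by auto
  then show "- pi < Im (Ln z)" by (rule mpi_less_Im_Ln)
  have "Im (Ln z) \<noteq> pi"
    using assms Im_Ln_eq_pi[OF \<open>z \<noteq> 0\<close>] by (auto simp: complex_nonpos_Reals_iff)
  then show "Im (Ln z) < pi" using Im_Ln_le_pi[OF \<open>z \<noteq> 0\<close>] by simp
qed

subsection \<open>Commuting pencils on an arc\<close>

lemma cis_minus_has_vector_derivative:
  "((\<lambda>\<theta>. cis (- \<theta>)) has_vector_derivative - (\<i> * cis (- \<theta>))) (at \<theta> within S)"
proof -
  have "((\<lambda>x. exp (- (\<i> * complex_of_real x))) has_vector_derivative
      - (\<i> * exp (- (\<i> * complex_of_real \<theta>)))) (at \<theta> within S)"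
    by (rule has_vector_derivative_real_field) (auto intro!: derivative_eq_intros)
  then show ?thesis by (simp add: cis_conv_exp)
qed

lemma mexp_scalar: "mexp (c *\<^sub>M mat 1 :: complex^'n^'n) = exp c *\<^sub>M mat 1"
proof -
  have "mexp (c *\<^sub>M mat 1 :: complex^'n^'n) *v v = (exp c *\<^sub>M mat 1) *v v" for v
    by (subst mexp_eigenvector[of _ v c]) (simp_all add: cscale_matvec)
  then show ?thesis by (simp add: matrix_eq)
qed

lemma commute_mult:
  fixes X A B :: "complex^'n^'n"
  assumes "X ** A = A ** X" "X ** B = B ** X"
  shows "X ** (A ** B) = (A ** B) ** X"
proof -
  have "X ** (A ** B) = A ** (X ** B)" by (simp add: matrix_mul_assoc assms(1))
  then show ?thesis by (simp add: assms(2) matrix_mul_assoc)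
qed

text \<open>The pencil normalised by the inverse of \<open>W\<close>. It is instantiated separately
  for each small \<epsilon>; the perturbation leaves \<open>affine\<close> unchanged.\<close>

locale pencil_arc =
  fixes F G :: "complex^'n^'n" and \<alpha> \<beta> :: complex and a b :: real
  assumes arc: "- pi < a" "a < b" "b < pi"
    and affine: "\<alpha> *\<^sub>M F + \<beta> *\<^sub>M G = mat 1"
    and regular: "\<And>\<theta>. \<theta> \<in> {a..b} \<Longrightarrow> invertible (cis \<theta> *\<^sub>M F - G)"
begin

text \<open>If one of the two coefficients is nonzero, \<open>affine\<close> expresses the
  corresponding matrix through the identity and the other matrix.\<close>

lemma comm: "F ** G = G ** F"
proof -
  have "(\<alpha> *\<^sub>M F + \<beta> *\<^sub>M G) ** G = G ** (\<alpha> *\<^sub>M F + \<beta> *\<^sub>M G)"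
    "F ** (\<alpha> *\<^sub>M F + \<beta> *\<^sub>M G) = (\<alpha> *\<^sub>M F + \<beta> *\<^sub>M G) ** F"
    by (simp_all add: affine)
  then have \<alpha>: "\<alpha> *\<^sub>M (F ** G) = \<alpha> *\<^sub>M (G ** F)" and \<beta>: "\<beta> *\<^sub>M (F ** G) = \<beta> *\<^sub>M (G ** F)"
    by (simp_all add: matmult.add_left matmult.add_right cscale_simps)
  show ?thesis
  proof (cases "\<alpha> = 0 \<and> \<beta> = 0")
    case True
    then have "mat 1 = (0 :: complex^'n^'n)" using affine by (simp add: cscale.zero_left)
    then show ?thesis by (metis matmult.zero_right matrix_mul_rid)
  next
    case False
    then show ?thesis
      using arg_cong[OF \<alpha>, of "\<lambda>X. (1 / \<alpha>) *\<^sub>M X"] arg_cong[OF \<beta>, of "\<lambda>X. (1 / \<beta>) *\<^sub>M X"]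
      by (auto simp: cscale_simps)
  qed
qed

definition res :: "real \<Rightarrow> complex^'n^'n" where
  "res \<theta> = matrix_inv (cis \<theta> *\<^sub>M F - G)"

definition int_res :: "real \<Rightarrow> complex^'n^'n" where
  "int_res \<theta> = integral {a..\<theta>} res"

text \<open>The explicit candidate for \<open>Y\<^sub>\<epsilon>\<close>; \<open>log_ratio\<close>
  below is the scalar \<eta>.\<close>

definition arc_log :: "complex^'n^'n" where
  "arc_log = \<i> *\<^sub>M (G ** int_res b)"

text \<open>This is \<Gamma> multiplied on the right by the inverse of \<open>W\<close>.\<close>

definition cayley :: "real \<Rightarrow> complex^'n^'n" where
  "cayley \<theta> = (complex_of_real (tan (\<theta> / 2)) - \<i>) *\<^sub>M F + (complex_of_real (tan (\<theta> / 2)) + \<i>) *\<^sub>M G"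

definition log_ratio :: complex where
  "log_ratio = Ln ((complex_of_real (tan (b / 2)) - \<i>) / (complex_of_real (tan (a / 2)) - \<i>))"

lemma res_commute:
  assumes "\<theta> \<in> {a..b}" "X ** F = F ** X" "X ** G = G ** X"
  shows "res \<theta> ** X = X ** res \<theta>"
  unfolding res_def
  by (intro matrix_inv_commute regular assms(1))
    (simp add: assms(2,3) matmult.diff_left matmult.diff_right cscale_simps)

lemma continuous_on_res: "continuous_on {a..b} res"
  unfolding res_def[abs_def]
  by (intro continuous_on_matrix_inv regular continuous_intros cscale.continuous_on)

lemma res_integrable: "\<theta> \<in> {a..b} \<Longrightarrow> res integrable_on {a..\<theta>}"
  by (rule integrable_continuous_real, rule continuous_on_subset[OF continuous_on_res]) auto

lemma int_res_commute:
  assumes "\<theta> \<in> {a..b}" "X ** F = F ** X" "X ** G = G ** X"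
  shows "int_res \<theta> ** X = X ** int_res \<theta>"
proof -
  have "((\<lambda>t. res t ** X) has_integral (int_res \<theta> ** X)) {a..\<theta>}"
    using has_integral_linear[OF integrable_integral[OF res_integrable[OF assms(1)]] matmult.bounded_linear_left]
    by (simp add: o_def int_res_def)
  moreover have "((\<lambda>t. X ** res t) has_integral (X ** int_res \<theta>)) {a..\<theta>}"
    using has_integral_linear[OF integrable_integral[OF res_integrable[OF assms(1)]] matmult.bounded_linear_right]
    by (simp add: o_def int_res_def)
  moreover have "res t ** X = X ** res t" if "t \<in> {a..\<theta>}" for t
    using that assms by (intro res_commute) auto
  ultimately show ?thesis
    using has_integral_unique has_integral_cong by (metis (no_types, lifting))
qed

lemma F_G_commute:
  assumes "\<theta> \<in> {a..b}"
  shows "F ** res \<theta> = res \<theta> ** F" "G ** res \<theta> = res \<theta> ** G"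
    "F ** int_res \<theta> = int_res \<theta> ** F" "G ** int_res \<theta> = int_res \<theta> ** G"
  using res_commute[OF assms, of F] res_commute[OF assms, of G]
    int_res_commute[OF assms, of F] int_res_commute[OF assms, of G] comm by auto

lemma b_in: "b \<in> {a..b}" and a_in: "a \<in> {a..b}"
  using arc by auto

lemma arc_log_commute:
  assumes "X ** F = F ** X" "X ** G = G ** X"
  shows "arc_log ** X = X ** arc_log"
proof -
  have "G ** int_res b ** X = G ** (X ** int_res b)"
    using int_res_commute[OF b_in assms] by (simp flip: matrix_mul_assoc)
  also have "\<dots> = X ** (G ** int_res b)"
    using assms(2) by (simp add: matrix_mul_assoc)
  finally show ?thesis by (simp add: arc_log_def cscale_simps)
qed

section \<open>The exponential of the candidate\<close>

text \<open>As \<open>F - cis (- \<theta>) *\<^sub>M G\<close> is \<open>cis (- \<theta>)\<close>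
  times the matrix inverted in \<open>res \<theta>\<close>, its derivative is itself times
  \<open>\<i> *\<^sub>M (G ** res \<theta>)\<close>. So \<open>mexp_path\<close> applies.\<close>

lemma mexp_arc_log: "F - cis (- b) *\<^sub>M G = (F - cis (- a) *\<^sub>M G) ** mexp arc_log"
proof -
  have "(\<lambda>\<theta>. F - cis (- \<theta>) *\<^sub>M G) b = (\<lambda>\<theta>. F - cis (- \<theta>) *\<^sub>M G) a ** mexp ((\<lambda>\<theta>. \<i> *\<^sub>M (G ** int_res \<theta>)) b)"
  proof (rule mexp_path[where f' = "\<lambda>\<theta>. \<i> *\<^sub>M (G ** res \<theta>)"])
    show "a \<le> b" using arc by simp
    show "\<i> *\<^sub>M (G ** int_res a) = 0" by (simp add: int_res_def cscale.zero_right)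
    show "continuous_on {a..b} (\<lambda>\<theta>. \<i> *\<^sub>M (G ** res \<theta>))"
      by (intro cscale.continuous_on matmult.continuous_on continuous_on_const continuous_on_res)
    fix t assume t: "t \<in> {a..b}"
    have "(int_res has_vector_derivative res t) (at t within {a..b})"
      unfolding int_res_def[abs_def] by (rule integral_has_vector_derivative[OF continuous_on_res t])
    then show "((\<lambda>\<theta>. \<i> *\<^sub>M (G ** int_res \<theta>)) has_vector_derivative \<i> *\<^sub>M (G ** res t)) (at t within {a..b})"
      by (intro bounded_linear.has_vector_derivative[OF cscale.bounded_linear_right]
         bounded_linear.has_vector_derivative[OF matmult.bounded_linear_right])
    \<comment> \<open>\<open>int_res t\<close> commutes with whatever commutes with \<open>F\<close>
      and \<open>G\<close>; this is checked for \<open>G ** res t\<close>, as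
      \<open>mexp_path\<close> needs the path to commute with its derivative.\<close>
    have "F ** (G ** res t) = (G ** res t) ** F" "G ** (G ** res t) = (G ** res t) ** G"
      using commute_mult[OF comm F_G_commute(1)[OF t]] commute_mult[OF refl F_G_commute(2)[OF t]] .
    then have "(G ** res t) ** (G ** int_res t) = (G ** int_res t) ** (G ** res t)"
      by (intro commute_mult int_res_commute[OF t, symmetric]) simp_all
    then show "(\<i> *\<^sub>M (G ** res t)) ** (\<i> *\<^sub>M (G ** int_res t)) = (\<i> *\<^sub>M (G ** int_res t)) ** (\<i> *\<^sub>M (G ** res t))"
      by (simp add: cscale_simps)
    have "F - cis (- t) *\<^sub>M G = cis (- t) *\<^sub>M (cis t *\<^sub>M F - G)"
      by (simp add: cscale.diff_right cscale_simps cis_mult)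
    then have "(F - cis (- t) *\<^sub>M G) ** (\<i> *\<^sub>M (G ** res t)) = (\<i> * cis (- t)) *\<^sub>M ((cis t *\<^sub>M F - G) ** (res t ** G))"
      by (simp add: cscale_simps F_G_commute(2)[OF t] mult.commute)
    also have "\<dots> = (\<i> * cis (- t)) *\<^sub>M G"
      using matrix_inv_mult(1)[OF regular[OF t]] by (simp add: matrix_mul_assoc res_def)
    finally have eq: "(F - cis (- t) *\<^sub>M G) ** (\<i> *\<^sub>M (G ** res t)) = (\<i> * cis (- t)) *\<^sub>M G" .
    have "((\<lambda>\<theta>. F - cis (- \<theta>) *\<^sub>M G) has_vector_derivative 0 - (- (\<i> * cis (- t))) *\<^sub>M G) (at t within {a..b})"
      by (intro has_vector_derivative_diff has_vector_derivative_const
         bounded_linear.has_vector_derivative[OF cscale.bounded_linear_left] cis_minus_has_vector_derivative)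
    then show "((\<lambda>\<theta>. F - cis (- \<theta>) *\<^sub>M G) has_vector_derivative
       (F - cis (- t) *\<^sub>M G) ** (\<i> *\<^sub>M (G ** res t))) (at t within {a..b})"
      unfolding eq by (simp add: cscale.minus_left)
  qed
  then show ?thesis by (simp add: arc_log_def)
qed

lemma cayley_eq:
  assumes "\<theta> \<in> {a..b}"
  shows "cayley \<theta> = (complex_of_real (tan (\<theta> / 2)) - \<i>) *\<^sub>M (F - cis (- \<theta>) *\<^sub>M G)"
proof -
  have "complex_of_real (tan (\<theta> / 2)) + \<i> = - (cis (- \<theta>) * (complex_of_real (tan (\<theta> / 2)) - \<i>))"
    using assms arc by (intro tan_half_cis) auto
  then show ?thesis
    by (simp add: cayley_def cscale.diff_right cscale.minus_left cscale_simps mult.commute)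
qed

lemma invertible_F_minus_G:
  assumes "\<theta> \<in> {a..b}"
  shows "invertible (F - cis (- \<theta>) *\<^sub>M G)"
proof (rule matrix_inv_unique_right(2))
  show "(F - cis (- \<theta>) *\<^sub>M G) ** (cis \<theta> *\<^sub>M res \<theta>) = mat 1"
  proof -
    have "F - cis (- \<theta>) *\<^sub>M G = cis (- \<theta>) *\<^sub>M (cis \<theta> *\<^sub>M F - G)"
      by (simp add: cscale.diff_right cscale_simps cis_mult)
    then show ?thesis
      using matrix_inv_mult(1)[OF regular[OF assms]] by (simp add: cscale_simps cis_mult res_def)
  qed
qed

lemma invertible_cayley:
  assumes "\<theta> \<in> {a..b}"
  shows "invertible (cayley \<theta>)"
proof (rule matrix_inv_unique_right(2))
  have "complex_of_real (tan (\<theta> / 2)) - \<i> \<noteq> 0"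
    using assms arc by (intro tan_half_cis) auto
  then show "cayley \<theta> ** ((1 / (complex_of_real (tan (\<theta> / 2)) - \<i>)) *\<^sub>M matrix_inv (F - cis (- \<theta>) *\<^sub>M G)) = mat 1"
    by (simp add: cayley_eq[OF assms] cscale_simps matrix_inv_mult[OF invertible_F_minus_G[OF assms]])
qed

text \<open>In \<open>cayley b\<close> and \<open>cayley a\<close> the ratio of the scalar
  prefactors from \<open>cayley_eq\<close> is the exponential of \<open>log_ratio\<close>; the
  matrix factors are related by \<open>mexp_arc_log\<close>.\<close>

lemma mexp_log_ratio_arc_log: "mexp (log_ratio *\<^sub>M mat 1 + arc_log) = cayley b ** matrix_inv (cayley a)"
proof -
  let ?ta = "complex_of_real (tan (a / 2)) - \<i>" and ?tb = "complex_of_real (tan (b / 2)) - \<i>"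
  let ?Z = "log_ratio *\<^sub>M mat 1 + arc_log"
  have nz: "?ta \<noteq> 0" "?tb \<noteq> 0"
    using arc by (intro tan_half_cis; simp)+
  then have "exp log_ratio = ?tb / ?ta" by (simp add: log_ratio_def)
  then have Z: "mexp ?Z = (?tb / ?ta) *\<^sub>M mexp arc_log"
    by (subst mexp_add) (simp_all add: mexp_scalar cscale_simps)
  have "cayley a ** mexp ?Z = (?ta * (?tb / ?ta)) *\<^sub>M ((F - cis (- a) *\<^sub>M G) ** mexp arc_log)"
    by (simp add: Z cayley_eq[OF a_in] cscale_simps mult.commute)
  also have "\<dots> = cayley b"
    using nz by (simp add: cayley_eq[OF b_in] mexp_arc_log[symmetric])
  finally have eq: "cayley a ** mexp ?Z = cayley b" .
  have "cayley a ** F = F ** cayley a" "cayley a ** G = G ** cayley a"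
    by (simp_all add: cayley_def matmult.add_left matmult.add_right cscale_simps comm)
  then have "?Z ** cayley a = cayley a ** ?Z"
    by (simp add: matmult.add_left matmult.add_right cscale_simps arc_log_commute)
  then have "mexp ?Z ** cayley a = cayley b"
    using mexp_commute eq by metis
  then have "cayley b ** matrix_inv (cayley a) = mexp ?Z ** (cayley a ** matrix_inv (cayley a))"
    by (simp add: matrix_mul_assoc)
  then show ?thesis by (simp add: matrix_inv_mult[OF invertible_cayley[OF a_in]])
qed

section \<open>The shifted candidate as principal logarithm\<close>

text \<open>On a common eigenvector the matrix integral reduces to
  \<open>cis_pencil_integral\<close>. A zero of the scalar pencil would put \<open>v\<close> into
  the kernel of an invertible matrix.\<close>

lemma arc_log_eigenvector:
  assumes v: "v \<noteq> 0" "F *v v = f *s v" "G *v v = g *s v"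
  shows "\<And>\<theta>. \<theta> \<in> {a..b} \<Longrightarrow> cis \<theta> * f \<noteq> g"
    "arc_log *v v = (Ln (cayley_line f g b / cayley_line f g a) - log_ratio) *s v"
proof -
  have N: "(cis \<theta> *\<^sub>M F - G) *v v = (cis \<theta> * f - g) *s v" for \<theta>
    by (simp add: matvec.diff_left cscale_matvec v vec.scale_left_diff_distrib)
  have res: "res \<theta> *v ((cis \<theta> * f - g) *s v) = v" if "\<theta> \<in> {a..b}" for \<theta>
    unfolding N[symmetric] matrix_vector_mul_assoc res_def
    by (simp add: matrix_inv_mult[OF regular[OF that]])
  show nz: "cis \<theta> * f \<noteq> g" if "\<theta> \<in> {a..b}" for \<theta>
    using res[OF that] v(1) by auto
  have "(\<i> *\<^sub>M (res \<theta> ** G)) *v v = (\<i> * g / (cis \<theta> * f - g)) *s v" if "\<theta> \<in> {a..b}" for \<theta>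
  proof -
    have "v = (cis \<theta> * f - g) *s (res \<theta> *v v)"
      using res[OF that] unfolding vec.scale by (rule sym)
    moreover have "w = (1 / c) *s v" if "c \<noteq> 0" "v = c *s w" for c and w :: "complex^'n"
      using that by (simp add: vec_eq_iff)
    ultimately have "res \<theta> *v v = (1 / (cis \<theta> * f - g)) *s v"
      using nz[OF that] by (metis eq_iff_diff_eq_0)
    then show ?thesis
      by (simp add: cscale_matvec v vec.scale flip: matrix_vector_mul_assoc)
  qed
  then have eq: "(\<i> *\<^sub>M (G ** res \<theta>)) *v v = (\<i> * g / (cis \<theta> * f - g)) *s v" if "\<theta> \<in> {a..b}" for \<theta>
    using that F_G_commute(2)[OF that] by simp
  have "((\<lambda>\<theta>. (\<i> *\<^sub>M (G ** res \<theta>)) *v v) has_integral (arc_log *v v)) {a..b}"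
    using has_integral_linear[OF integrable_integral[OF res_integrable[OF b_in]]
        bounded_linear_compose[OF matvec.bounded_linear_left[of v]
          bounded_linear_compose[OF cscale.bounded_linear_right[of \<i>] matmult.bounded_linear_right[of G]]]]
    by (simp add: o_def int_res_def arc_log_def)
  moreover have "((\<lambda>\<theta>. (\<i> *\<^sub>M (G ** res \<theta>)) *v v) has_integral
      ((Ln (cayley_line f g b / cayley_line f g a) - log_ratio) *s v)) {a..b}"
  proof -
    have "((\<lambda>\<theta>. \<i> * g / (cis \<theta> * f - g)) has_integral (Ln (cayley_line f g b / cayley_line f g a) - log_ratio)) {a..b}"
      using cis_pencil_integral[of a b f g] arc nz by (simp add: log_ratio_def cayley_line_def)
    from has_integral_linear[OF this bounded_linear_scalar_mult_left[of v]]
    have "((\<lambda>\<theta>. (\<i> * g / (cis \<theta> * f - g)) *s v) has_integral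
      ((Ln (cayley_line f g b / cayley_line f g a) - log_ratio) *s v)) {a..b}"
      by (simp add: o_def)
    then show ?thesis by (rule has_integral_eq[rotated]) (simp add: eq)
  qed
  ultimately show "arc_log *v v = (Ln (cayley_line f g b / cayley_line f g a) - log_ratio) *s v"
    by (rule has_integral_unique)
qed

text \<open>An eigenspace of the shifted candidate is invariant under \<open>F\<close>, and its
  intersection with an eigenspace of \<open>F\<close> is invariant under \<open>G\<close>. This
  gives a common eigenvector, on which \<mu> is \<open>Ln\<close> of a number off the cut.\<close>

lemma log_strip_log_ratio_arc_log: "log_strip (log_ratio *\<^sub>M mat 1 + arc_log)"
  unfolding log_strip_def
proof (intro allI impI)
  let ?Z = "log_ratio *\<^sub>M mat 1 + arc_log"
  fix \<mu> assume "mat_eigenvalue ?Z \<mu>"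
  then obtain v where v: "v \<noteq> 0" "?Z *v v = \<mu> *s v" by (auto simp: mat_eigenvalue_iff)
  have FZ: "F ** ?Z = ?Z ** F" and GZ: "G ** ?Z = ?Z ** G"
    using arc_log_commute[of F] arc_log_commute[of G] comm
    by (simp_all add: matmult.add_left matmult.add_right cscale_simps)
  let ?V = "{v. ?Z *v v = \<mu> *s v}"
  have "F *v x \<in> ?V" if "x \<in> ?V" for x
    using eigenspace_invariant[OF FZ] that by simp
  then obtain x f where x: "?Z *v x = \<mu> *s x" "x \<noteq> 0" "F *v x = f *s x"
    using exists_eigenvector[OF eigenspace_subspace[of ?Z \<mu>], of F v] v by auto
  let ?U = "?V \<inter> {v. F *v v = f *s v}"
  have "G *v y \<in> ?U" if "y \<in> ?U" for y
    using eigenspace_invariant[OF GZ] eigenspace_invariant[OF comm[symmetric]] that by simp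
  then obtain y g where y: "?Z *v y = \<mu> *s y" "y \<noteq> 0" "F *v y = f *s y" "G *v y = g *s y"
    using exists_eigenvector[OF vec.subspace_inter[OF eigenspace_subspace[of ?Z \<mu>] eigenspace_subspace[of F f]], of G x] x
    by auto
  have "?Z *v y = log_ratio *s y + (Ln (cayley_line f g b / cayley_line f g a) - log_ratio) *s y"
    using arc_log_eigenvector(2)[OF y(2-4)] by (simp add: matvec.add_left cscale_matvec)
  also have "\<dots> = Ln (cayley_line f g b / cayley_line f g a) *s y"
    by (simp add: vec.scale_left_diff_distrib)
  finally have "\<mu> = Ln (cayley_line f g b / cayley_line f g a)"
    using y(1,2) by (metis vec.scale_right_imp_eq)
  moreover have "cayley_line f g b / cayley_line f g a \<notin> \<real>\<^sub>\<le>\<^sub>0"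
    using arc arc_log_eigenvector(1)[OF y(2-4)] by (intro cayley_line_quotient) auto
  ultimately show "- pi < Im \<mu> \<and> Im \<mu> < pi" using Im_Ln_bounds by blast
qed

text \<open>Needed for uniqueness: a competing logarithm is known to commute only with its own
  exponential. The idea is that \<open>F\<close> and \<open>G\<close> are rational functions of the
  quotient.\<close>

lemma commute_if_commute_quotient:
  assumes X: "X ** (cayley b ** matrix_inv (cayley a)) = (cayley b ** matrix_inv (cayley a)) ** X"
  shows "X ** F = F ** X" "X ** G = G ** X"
proof -
  define B where "B = cayley b ** matrix_inv (cayley a)"
  define ta tb where "ta = complex_of_real (tan (a / 2))" and "tb = complex_of_real (tan (b / 2))"
  \<comment> \<open>The determinant of the 2 by 2 system expressing \<open>cayley a\<close> and
    \<open>cayley b\<close> through \<open>F\<close> and \<open>G\<close>; it is nonzero because the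
    tangents differ.\<close>
  define D where "D = (ta - \<i>) * (tb + \<i>) - (tb - \<i>) * (ta + \<i>)"
  have "tan (a / 2) < tan (b / 2)" using arc by (intro tan_monotone) auto
  then have "ta \<noteq> tb" by (simp add: ta_def tb_def)
  moreover have "D = 2 * \<i> * (ta - tb)" by (simp add: D_def algebra_simps)
  ultimately have D: "D \<noteq> 0" by simp
  have ca: "cayley a = (ta - \<i>) *\<^sub>M F + (ta + \<i>) *\<^sub>M G" and cb: "cayley b = (tb - \<i>) *\<^sub>M F + (tb + \<i>) *\<^sub>M G"
    by (simp_all add: cayley_def ta_def tb_def)
  have DF: "D *\<^sub>M F = (tb + \<i>) *\<^sub>M cayley a - (ta + \<i>) *\<^sub>M cayley b"
    and DG: "D *\<^sub>M G = (ta - \<i>) *\<^sub>M cayley b - (tb - \<i>) *\<^sub>M cayley a"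
    unfolding ca cb D_def by (simp_all add: vec_eq_iff cscale_def algebra_simps)
  have cbB: "cayley b = B ** cayley a"
    by (simp add: B_def matrix_inv_mult[OF invertible_cayley[OF a_in]] flip: matrix_mul_assoc)
  \<comment> \<open>Inserting \<open>DF\<close> and \<open>DG\<close> into \<open>affine\<close> and
    factoring \<open>cayley a\<close> out on the right leaves this expression, affine in
    \<open>B\<close>. Hence \<open>cayley a\<close> is \<open>D\<close> times the inverse of
    \<open>H\<close>.\<close>
  define H where "H = (\<alpha> * (tb + \<i>) - \<beta> * (tb - \<i>)) *\<^sub>M mat 1 + (\<beta> * (ta - \<i>) - \<alpha> * (ta + \<i>)) *\<^sub>M B"
  have "H ** cayley a = (\<alpha> * (tb + \<i>) - \<beta> * (tb - \<i>)) *\<^sub>M cayley a + (\<beta> * (ta - \<i>) - \<alpha> * (ta + \<i>)) *\<^sub>M cayley b"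
    by (simp add: H_def matmult.add_left cscale_simps cbB)
  also have "\<dots> = \<alpha> *\<^sub>M (D *\<^sub>M F) + \<beta> *\<^sub>M (D *\<^sub>M G)"
    unfolding DF DG by (simp add: vec_eq_iff cscale_def algebra_simps)
  also have "\<dots> = D *\<^sub>M (\<alpha> *\<^sub>M F + \<beta> *\<^sub>M G)"
    by (simp add: cscale_simps cscale.add_right mult.commute)
  finally have "H ** cayley a = D *\<^sub>M mat 1" by (simp only: affine)
  then have "H ** ((1 / D) *\<^sub>M cayley a) = mat 1" using D by (simp add: cscale_simps)
  note H = matrix_inv_unique_right[OF this]
  have "H ** X = X ** H"
    using X by (simp add: H_def B_def[symmetric] matmult.add_left matmult.add_right cscale_simps)
  from matrix_inv_commute[OF H(2) this] have "D *\<^sub>M (((1 / D) *\<^sub>M cayley a) ** X) = D *\<^sub>M (X ** ((1 / D) *\<^sub>M cayley a))"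
    by (simp add: H(1))
  then have Xa: "X ** cayley a = cayley a ** X" using D by (simp add: cscale_simps)
  have Xb: "X ** cayley b = cayley b ** X"
    unfolding cbB using X Xa unfolding B_def[symmetric] by (rule commute_mult)
  have "(1 / D) *\<^sub>M (X ** (D *\<^sub>M F)) = (1 / D) *\<^sub>M ((D *\<^sub>M F) ** X)"
    unfolding DF by (simp add: Xa Xb matmult.diff_left matmult.diff_right cscale_simps)
  then show "X ** F = F ** X" using D by (simp add: cscale_simps)
  have "(1 / D) *\<^sub>M (X ** (D *\<^sub>M G)) = (1 / D) *\<^sub>M ((D *\<^sub>M G) ** X)"
    unfolding DG by (simp add: Xa Xb matmult.diff_left matmult.diff_right cscale_simps)
  then show "X ** G = G ** X" using D by (simp add: cscale_simps)
qed

lemma mlog_cayley_quotient: "mlog (cayley b ** matrix_inv (cayley a)) = log_ratio *\<^sub>M mat 1 + arc_log"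
  unfolding mlog_def log_strip_def[symmetric]
proof (rule the_equality)
  show "mexp (log_ratio *\<^sub>M mat 1 + arc_log) = cayley b ** matrix_inv (cayley a) \<and> log_strip (log_ratio *\<^sub>M mat 1 + arc_log)"
    by (simp add: mexp_log_ratio_arc_log log_strip_log_ratio_arc_log)
  fix X assume X: "mexp X = cayley b ** matrix_inv (cayley a) \<and> log_strip X"
  have "X ** mexp X = mexp X ** X" by (simp add: mexp_commute)
  then have "X ** F = F ** X" "X ** G = G ** X"
    using X commute_if_commute_quotient by auto
  then have "X ** (log_ratio *\<^sub>M mat 1 + arc_log) = (log_ratio *\<^sub>M mat 1 + arc_log) ** X"
    by (simp add: matmult.add_left matmult.add_right cscale_simps arc_log_commute)
  then show "X = log_ratio *\<^sub>M mat 1 + arc_log"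
  proof (rule mexp_inj_log_strip)
    show "mexp X = mexp (log_ratio *\<^sub>M mat 1 + arc_log)" unfolding mexp_log_ratio_arc_log using X by (rule conjunct1)
    show "log_strip X" using X by (rule conjunct2)
  qed (rule log_strip_log_ratio_arc_log)
qed

text \<open>After multiplication by \<open>G\<close>, the product \<open>G ** int_res b\<close> is a
  multiple of \<open>arc_log\<close>, so \<open>psi1_mult\<close> produces
  \<open>mexp arc_log - mat 1\<close>. Applied to the endpoint matrix at \<open>a\<close>, this
  gives a difference of endpoint matrices, in which \<open>F\<close> cancels and a multiple of
  \<open>G\<close> remains.\<close>

lemma psi1_arc_log:
  assumes "invertible G"
  shows "psi1 arc_log ** (int_res b ** (F - cis (- a) *\<^sub>M G)) = (\<i> * (cis (- b) - cis (- a))) *\<^sub>M mat 1"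
proof -
  let ?Qa = "F - cis (- a) *\<^sub>M G" and ?Qb = "F - cis (- b) *\<^sub>M G"
  have QF: "?Qa ** F = F ** ?Qa" "?Qa ** G = G ** ?Qa"
    by (simp_all add: matmult.diff_left matmult.diff_right cscale_simps comm)
  have Gl: "arc_log ** G = G ** arc_log" using arc_log_commute[of G] comm by simp
  have "G ** (psi1 arc_log ** (int_res b ** ?Qa)) = psi1 arc_log ** (G ** int_res b) ** ?Qa"
    using psi1_commute[OF Gl] by (simp add: matrix_mul_assoc)
  also have "\<dots> = (- \<i>) *\<^sub>M (psi1 arc_log ** arc_log ** ?Qa)"
    by (simp add: arc_log_def cscale_simps)
  also have "psi1 arc_log ** arc_log = mexp arc_log - mat 1"
    using psi1_commute[of arc_log arc_log] psi1_mult[of arc_log] by simp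
  also have "(mexp arc_log - mat 1) ** ?Qa = ?Qb - ?Qa"
    using mexp_commute[OF arc_log_commute[OF QF]] mexp_arc_log by (simp add: matmult.diff_left)
  also have "(- \<i>) *\<^sub>M (?Qb - ?Qa) = (\<i> * (cis (- b) - cis (- a))) *\<^sub>M G"
    by (simp add: vec_eq_iff cscale_def algebra_simps)
  finally have "matrix_inv G ** (G ** (psi1 arc_log ** (int_res b ** ?Qa))) = matrix_inv G ** ((\<i> * (cis (- b) - cis (- a))) *\<^sub>M G)"
    by simp
  then show ?thesis
    by (simp add: matrix_mul_assoc cscale_simps matrix_inv_mult[OF assms])
qed

end

subsection \<open>Perturbing the pencil\<close>

lemma invertible_matrix_mult_iff:
  fixes A B :: "complex^'n^'n"
  shows "invertible (A ** B) \<longleftrightarrow> invertible A \<and> invertible B"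
  by (simp add: invertible_det_nz det_mul)

lemma matrix_inv_mult_distrib:
  fixes A B :: "complex^'n^'n"
  assumes "invertible A" "invertible B"
  shows "matrix_inv (A ** B) = matrix_inv B ** matrix_inv A"
proof (rule matrix_inv_unique_right)
  have "A ** B ** (matrix_inv B ** matrix_inv A) = A ** (B ** matrix_inv B) ** matrix_inv A"
    by (simp add: matrix_mul_assoc)
  then show "A ** B ** (matrix_inv B ** matrix_inv A) = mat 1"
    by (simp add: matrix_inv_mult assms)
qed

text \<open>The powers of \<open>X\<close>, flattened to vectors indexed by pairs, satisfy a
  polynomial relation, and every eigenvalue is a root of it.\<close>

lemma finite_mat_eigenvalues:
  fixes X :: "complex^'n^'n"
  shows "finite {\<mu>. mat_eigenvalue X \<mu>}"
proof -
  obtain p where p: "p \<noteq> 0"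
    "(\<Sum>i\<le>degree p. coeff p i *s (\<chi> q :: 'n \<times> 'n. matpow X i $ fst q $ snd q)) = 0"
    using exists_annihilating_poly[of "\<lambda>i. \<chi> q :: 'n \<times> 'n. matpow X i $ fst q $ snd q"] by blast
  have ann: "(\<Sum>i\<le>degree p. coeff p i *\<^sub>M matpow X i) = 0"
  proof -
    have "(\<Sum>i\<le>degree p. coeff p i *\<^sub>M matpow X i) $ j $ k = 0" for j k
      using arg_cong[OF p(2), of "\<lambda>x. x $ (j, k)"] by (simp add: cscale_def)
    then show ?thesis by (simp add: vec_eq_iff)
  qed
  have "poly p \<mu> = 0" if eig: "mat_eigenvalue X \<mu>" for \<mu>
  proof -
    obtain v where v: "v \<noteq> 0" "X *v v = \<mu> *s v" using eig by (auto simp: mat_eigenvalue_iff)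
    have "0 = (\<Sum>i\<le>degree p. coeff p i *\<^sub>M matpow X i) *v v" by (simp add: ann)
    also have "\<dots> = (\<Sum>i\<le>degree p. (coeff p i * \<mu> ^ i) *s v)"
      by (simp add: matvec.sum_left cscale_matvec matpow_eigenvector[OF v(2)])
    also have "\<dots> = poly p \<mu> *s v"
      by (simp add: poly_altdef vec.scale_sum_left)
    finally show ?thesis using v(1) by simp
  qed
  then have "{\<mu>. mat_eigenvalue X \<mu>} \<subseteq> {\<mu>. poly p \<mu> = 0}" by blast
  then show ?thesis using poly_roots_finite[OF p(1)] finite_subset by blast
qed

text \<open>The shift is singular only if \<open>- (c * \<epsilon>)\<close> is an eigenvalue of
  \<open>X\<close>; finitely many such \<epsilon> are avoided near 0.\<close>

lemma eventually_invertible_shift: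
  fixes X :: "complex^'n^'n"
  assumes "c \<noteq> 0"
  shows "\<forall>\<^sub>F \<epsilon> in at 0. invertible (X + (c * \<epsilon>) *\<^sub>M mat 1)"
proof -
  let ?S = "{\<epsilon>. mat_eigenvalue X (- (c * \<epsilon>))}"
  have "inj (\<lambda>\<epsilon>. - (c * \<epsilon>))" using assms by (auto intro: injI)
  then have "finite ?S"
    using finite_vimageI[OF finite_mat_eigenvalues[of X]] by (simp add: vimage_def)
  then have "\<forall>\<^sub>F \<epsilon> in at 0. \<epsilon> \<notin> ?S"
    using islimpt_finite[of ?S 0] by (simp add: islimpt_iff_eventually)
  then show ?thesis
  proof eventually_elim
    case (elim \<epsilon>)
    show ?case
    proof (rule matrix_kernel_trivial_imp_invertible, rule ccontr)
      fix v assume v: "(X + (c * \<epsilon>) *\<^sub>M mat 1) *v v = 0" "v \<noteq> 0"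
      then have "X *v v = (- (c * \<epsilon>)) *s v"
        by (simp add: matvec.add_left cscale_matvec eq_neg_iff_add_eq_0)
      with v(2) elim show False by (auto simp: mat_eigenvalue_iff)
    qed
  qed
qed

lemma wrap_eq: "- pi < \<phi> \<Longrightarrow> \<phi> \<le> pi \<Longrightarrow> wrap \<phi> = \<phi>"
  unfolding wrap_def by (rule cis_Arg_unique) (simp_all add: sgn_eq)

lemma open_invertible_vimage:
  fixes f :: "'a::topological_space \<Rightarrow> complex^'n^'n"
  assumes "continuous_on UNIV f"
  shows "open {x. invertible (f x)}"
proof -
  have "continuous_on UNIV (\<lambda>x. det (f x))"
    unfolding det_def by (intro continuous_intros assms)
  then have "open {x. det (f x) \<noteq> 0}"
    by (intro open_Collect_neq continuous_on_const)
  then show ?thesis by (simp add: invertible_det_nz)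
qed

theorem theorem4:
  fixes A E :: "real^'n^'n" and \<alpha> \<beta> :: complex and \<theta>\<^sub>1 \<theta>\<^sub>2 :: real
    and A\<^sub>\<epsilon> E\<^sub>\<epsilon> :: "complex \<Rightarrow> complex^'n^'n"
    and \<Gamma> :: "real \<Rightarrow> complex \<Rightarrow> complex^'n^'n"
    and W Y L :: "complex^'n^'n" and \<eta> :: complex and Y\<^sub>\<epsilon> :: "complex \<Rightarrow> complex^'n^'n"
  assumes reg: "regular_pencil A E"
    and W_def: "W = \<alpha> *\<^sub>M cmat E + \<beta> *\<^sub>M cmat A"
    and W_inv: "invertible W"
    and th1: "-pi < \<theta>\<^sub>1" and th12: "\<theta>\<^sub>1 < \<theta>\<^sub>2" and th2: "\<theta>\<^sub>2 < pi"
    and no_eig: "\<And>\<phi>. wrap \<phi> \<in> {\<theta>\<^sub>1..\<theta>\<^sub>2} \<Longrightarrow> \<not> pencil_eigenvalue A E (cis \<phi>)"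
    and A\<epsilon>_def: "\<And>\<epsilon>. A\<^sub>\<epsilon> \<epsilon> = cmat A + (\<alpha> * \<epsilon>) *\<^sub>M mat 1"
    and E\<epsilon>_def: "\<And>\<epsilon>. E\<^sub>\<epsilon> \<epsilon> = cmat E - (\<beta> * \<epsilon>) *\<^sub>M mat 1"
    and \<Gamma>_def: "\<And>\<theta> \<epsilon>. \<Gamma> \<theta> \<epsilon> =
        complex_of_real (tan (\<theta> / 2)) *\<^sub>M (E\<^sub>\<epsilon> \<epsilon> + A\<^sub>\<epsilon> \<epsilon>) - \<i> *\<^sub>M (E\<^sub>\<epsilon> \<epsilon> - A\<^sub>\<epsilon> \<epsilon>)"
    and \<eta>_def: "\<eta> = Ln ((complex_of_real (tan (\<theta>\<^sub>2 / 2)) - \<i>) / (complex_of_real (tan (\<theta>\<^sub>1 / 2)) - \<i>))"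
    and Y\<epsilon>_def: "\<And>\<epsilon>. Y\<^sub>\<epsilon> \<epsilon> = - (\<eta> *\<^sub>M mat 1) + mlog (\<Gamma> \<theta>\<^sub>2 \<epsilon> ** matrix_inv (\<Gamma> \<theta>\<^sub>1 \<epsilon>))"
    and Y_def: "Y = - (\<eta> *\<^sub>M mat 1) + mlog (\<Gamma> \<theta>\<^sub>2 0 ** matrix_inv (\<Gamma> \<theta>\<^sub>1 0))"
    and L_def: "L = matrix_inv (psi1 Y)"
  shows "(Y\<^sub>\<epsilon> \<longlongrightarrow> Y) (at 0)
    \<and> invertible (psi1 Y)
    \<and> ((\<lambda>\<epsilon>. matrix_inv (mexp (Y\<^sub>\<epsilon> \<epsilon>) - mat 1) ** Y\<^sub>\<epsilon> \<epsilon>) \<longlongrightarrow> L) (at 0)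
    \<and> ((\<lambda>\<theta>. resolvent A E (cis \<theta>)) has_integral
         ((1 / \<i>) *\<^sub>M (matrix_inv W **
            (- (\<alpha> *\<^sub>M (L ** (cis (- \<theta>\<^sub>2) *\<^sub>M mat 1 - cis (- \<theta>\<^sub>1) *\<^sub>M mexp Y)))
             + \<beta> *\<^sub>M Y)))) {\<theta>\<^sub>1..\<theta>\<^sub>2}"
proof -
  define Wi where "Wi = matrix_inv W"
  define F where "F \<epsilon> = E\<^sub>\<epsilon> \<epsilon> ** Wi" for \<epsilon>
  define G where "G \<epsilon> = A\<^sub>\<epsilon> \<epsilon> ** Wi" for \<epsilon>
  define J where "J \<epsilon> = integral {\<theta>\<^sub>1..\<theta>\<^sub>2} (\<lambda>\<theta>. matrix_inv (cis \<theta> *\<^sub>M F \<epsilon> - G \<epsilon>))" for \<epsilon>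
  define Q where "Q \<epsilon> = F \<epsilon> - cis (- \<theta>\<^sub>1) *\<^sub>M G \<epsilon>" for \<epsilon>
  define T where "T \<epsilon> = \<i> *\<^sub>M (G \<epsilon> ** J \<epsilon>)" for \<epsilon>
  define \<kappa> where "\<kappa> = \<i> * (cis (- \<theta>\<^sub>2) - cis (- \<theta>\<^sub>1))"
  have WWi: "W ** Wi = mat 1" "Wi ** W = mat 1"
    unfolding Wi_def by (rule matrix_inv_mult[OF W_inv])+
  have Wi_inv: "invertible Wi" using matrix_inv_unique_right(2)[OF WWi(2)] .
  \<comment> \<open>Distinct angles in the open interval have distinct \<open>cis\<close>. Dividing
    by this scalar later turns the identity for \<open>psi1\<close> into an explicit
    inverse.\<close>
  have \<kappa>: "\<kappa> \<noteq> 0"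
  proof
    assume "\<kappa> = 0"
    then have "cis (- \<theta>\<^sub>2) = cis (- \<theta>\<^sub>1)" by (simp add: \<kappa>_def)
    then have "wrap (- \<theta>\<^sub>2) = wrap (- \<theta>\<^sub>1)" by (simp add: wrap_def)
    then show False using wrap_eq[of "- \<theta>\<^sub>1"] wrap_eq[of "- \<theta>\<^sub>2"] th1 th12 th2 by simp
  qed

  have cont_F: "continuous_on S F" and cont_G: "continuous_on S G" for S
    unfolding F_def[abs_def] G_def[abs_def] A\<epsilon>_def E\<epsilon>_def
    by (intro matmult.continuous_on cscale.continuous_on continuous_intros)+
  have cont_N: "continuous_on S (\<lambda>p. cis (snd p) *\<^sub>M F (fst p) - G (fst p))" for S
    by (intro continuous_intros cscale.continuous_on continuous_on_compose2[OF cont_F[of UNIV]]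
        continuous_on_compose2[OF cont_G[of UNIV]]) auto

  have N0: "invertible (cis \<theta> *\<^sub>M F 0 - G 0)" if "\<theta> \<in> {\<theta>\<^sub>1..\<theta>\<^sub>2}" for \<theta>
  proof -
    have "wrap \<theta> = \<theta>" using that th1 th2 by (intro wrap_eq) auto
    then have "invertible (cmat A - cis \<theta> *\<^sub>M cmat E)"
      using no_eig[of \<theta>] that by (simp add: pencil_eigenvalue_def invertible_det_nz)
    then have "invertible (- (cmat A - cis \<theta> *\<^sub>M cmat E))"
      by (intro matrix_inv_unique_right(2)[of _ "- matrix_inv (cmat A - cis \<theta> *\<^sub>M cmat E)"])
        (simp only: matmult.minus_left matmult.minus_right minus_minus matrix_inv_mult)
    moreover have "cis \<theta> *\<^sub>M F 0 - G 0 = - (cmat A - cis \<theta> *\<^sub>M cmat E) ** Wi"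
      by (simp add: F_def G_def A\<epsilon>_def E\<epsilon>_def cscale.zero_left matmult.diff_left cscale_simps)
    ultimately show ?thesis by (simp add: invertible_matrix_mult_iff Wi_inv)
  qed
  \<comment> \<open>Invertibility is an open condition in (\<epsilon>, \<theta>) jointly, so
    compactness of the arc yields one neighbourhood \<open>U\<close> of 0 that works for all
    angles.\<close>
  have "{0} \<times> {\<theta>\<^sub>1..\<theta>\<^sub>2} \<subseteq> {p. invertible (cis (snd p) *\<^sub>M F (fst p) - G (fst p))}"
    using N0 by auto
  from Elementary_Topology.tube_lemma[OF compact_Icc open_invertible_vimage[OF cont_N] this]
  obtain U where U: "0 \<in> U" "open U"
    and U_sub: "U \<times> {\<theta>\<^sub>1..\<theta>\<^sub>2} \<subseteq> {p. invertible (cis (snd p) *\<^sub>M F (fst p) - G (fst p))}"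
    by blast
  have N_inv: "invertible (cis \<theta> *\<^sub>M F \<epsilon> - G \<epsilon>)" if "\<epsilon> \<in> U" "\<theta> \<in> {\<theta>\<^sub>1..\<theta>\<^sub>2}" for \<epsilon> \<theta>
    using subsetD[OF U_sub, of "(\<epsilon>, \<theta>)"] that by simp

  have affine: "\<alpha> *\<^sub>M F \<epsilon> + \<beta> *\<^sub>M G \<epsilon> = mat 1" for \<epsilon>
  proof -
    have "\<alpha> *\<^sub>M E\<^sub>\<epsilon> \<epsilon> + \<beta> *\<^sub>M A\<^sub>\<epsilon> \<epsilon> = W"
      unfolding W_def A\<epsilon>_def E\<epsilon>_def by (simp add: vec_eq_iff cscale_def algebra_simps)
    then have "(\<alpha> *\<^sub>M E\<^sub>\<epsilon> \<epsilon> + \<beta> *\<^sub>M A\<^sub>\<epsilon> \<epsilon>) ** Wi = mat 1" by (simp add: WWi)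
    then show ?thesis by (simp add: F_def G_def matmult.add_left cscale_simps)
  qed
  have arc: "pencil_arc (F \<epsilon>) (G \<epsilon>) \<alpha> \<beta> \<theta>\<^sub>1 \<theta>\<^sub>2" if "\<epsilon> \<in> U" for \<epsilon>
    by unfold_locales (use th1 th12 th2 affine N_inv[OF that] in auto)
  have J_eq: "pencil_arc.int_res (F \<epsilon>) (G \<epsilon>) \<theta>\<^sub>1 \<theta>\<^sub>2 = J \<epsilon>" if "\<epsilon> \<in> U" for \<epsilon>
    unfolding pencil_arc.int_res_def[OF arc[OF that]] pencil_arc.res_def[OF arc[OF that], abs_def] J_def ..
  have T_eq: "pencil_arc.arc_log (F \<epsilon>) (G \<epsilon>) \<theta>\<^sub>1 \<theta>\<^sub>2 = T \<epsilon>" if "\<epsilon> \<in> U" for \<epsilon>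
    unfolding pencil_arc.arc_log_def[OF arc[OF that]] J_eq[OF that] T_def ..

  have Y\<epsilon>_eq: "Y\<^sub>\<epsilon> \<epsilon> = T \<epsilon>" if \<epsilon>: "\<epsilon> \<in> U" for \<epsilon>
  proof -
    interpret pencil_arc "F \<epsilon>" "G \<epsilon>" \<alpha> \<beta> \<theta>\<^sub>1 \<theta>\<^sub>2 by (rule arc[OF \<epsilon>])
    have FW: "F \<epsilon> ** W = E\<^sub>\<epsilon> \<epsilon>" "G \<epsilon> ** W = A\<^sub>\<epsilon> \<epsilon>"
      by (simp_all add: F_def G_def WWi flip: matrix_mul_assoc)
    \<comment> \<open>The common right factor \<open>W\<close> cancels in the quotient, so the
      logarithm is the one computed in the locale.\<close>
    have \<Gamma>_eq: "\<Gamma> \<theta> \<epsilon> = cayley \<theta> ** W" for \<theta>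
      unfolding cayley_def matmult.add_left cscale_mult_left FW \<Gamma>_def
      by (simp add: vec_eq_iff cscale_def algebra_simps)
    have "\<Gamma> \<theta>\<^sub>2 \<epsilon> ** matrix_inv (\<Gamma> \<theta>\<^sub>1 \<epsilon>) = cayley \<theta>\<^sub>2 ** (W ** Wi) ** matrix_inv (cayley \<theta>\<^sub>1)"
      unfolding \<Gamma>_eq matrix_inv_mult_distrib[OF invertible_cayley[OF a_in] W_inv] Wi_def
      by (simp add: matrix_mul_assoc)
    also have "\<dots> = cayley \<theta>\<^sub>2 ** matrix_inv (cayley \<theta>\<^sub>1)" by (simp add: WWi)
    finally show ?thesis
      unfolding Y\<epsilon>_def by (simp add: mlog_cayley_quotient T_eq[OF \<epsilon>] \<eta>_def log_ratio_def)
  qed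
  have Y_eq: "Y = T 0" using Y\<epsilon>_eq[OF U(1)] by (simp add: Y_def Y\<epsilon>_def)

  \<comment> \<open>Limits as \<epsilon> tends to 0\<close>
  have cont_J: "continuous_on U J"
  proof -
    have "continuous_on (U \<times> cbox \<theta>\<^sub>1 \<theta>\<^sub>2) (\<lambda>(\<epsilon>, \<theta>). matrix_inv (cis \<theta> *\<^sub>M F \<epsilon> - G \<epsilon>))"
      unfolding case_prod_unfold
      by (rule continuous_on_matrix_inv[OF cont_N]) (auto intro: N_inv)
    from integral_continuous_on_param[OF this] show ?thesis
      unfolding J_def[abs_def] by (simp add: cbox_interval)
  qed
  have cont_T: "continuous_on U T" and cont_JQ: "continuous_on U (\<lambda>\<epsilon>. J \<epsilon> ** Q \<epsilon>)"
    unfolding T_def[abs_def] Q_def[abs_def]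
    by (intro cscale.continuous_on matmult.continuous_on continuous_intros cont_F cont_G cont_J)+
  have lim_T: "(T \<longlongrightarrow> T 0) (at 0)" and lim_JQ: "((\<lambda>\<epsilon>. J \<epsilon> ** Q \<epsilon>) \<longlongrightarrow> J 0 ** Q 0) (at 0)"
    using cont_T cont_JQ U by (simp_all add: continuous_on_eq_continuous_at isCont_def)
  have ev_U: "\<forall>\<^sub>F \<epsilon> in at 0. \<epsilon> \<in> U"
    using U by (simp add: eventually_at_topological) blast
  have lim_Y: "(Y\<^sub>\<epsilon> \<longlongrightarrow> Y) (at 0)"
    unfolding Y_eq by (rule Lim_transform_eventually[OF lim_T]) (use ev_U Y\<epsilon>_eq in \<open>auto elim: eventually_mono\<close>)

  \<comment> \<open>If \<alpha> = 0, then \<open>W\<close> is \<beta> times \<open>cmat A\<close>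
    and the perturbation does not change it; otherwise the shift lemma applies.\<close>
  have "\<forall>\<^sub>F \<epsilon> in at 0. invertible (A\<^sub>\<epsilon> \<epsilon>)"
  proof (cases "\<alpha> = 0")
    case True
    then have "cmat A ** (\<beta> *\<^sub>M Wi) = mat 1"
      using WWi(1) by (simp add: W_def cscale.zero_left cscale_simps)
    then have "invertible (cmat A)" by (rule matrix_inv_unique_right)
    then show ?thesis using True by (simp add: A\<epsilon>_def cscale.zero_left)
  next
    case False
    then show ?thesis unfolding A\<epsilon>_def by (rule eventually_invertible_shift)
  qed
  then have ev_G: "\<forall>\<^sub>F \<epsilon> in at 0. \<epsilon> \<in> U \<and> invertible (G \<epsilon>)"
    using ev_U by eventually_elim (simp add: G_def invertible_matrix_mult_iff Wi_inv)
  have psi: "psi1 (T \<epsilon>) ** (J \<epsilon> ** Q \<epsilon>) = \<kappa> *\<^sub>M mat 1" if "\<epsilon> \<in> U" "invertible (G \<epsilon>)" for \<epsilon>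
    using pencil_arc.psi1_arc_log[OF arc[OF that(1)] that(2)]
    unfolding J_eq[OF that(1)] T_eq[OF that(1)] Q_def \<kappa>_def .
  \<comment> \<open>The cancellation of \<^term>\<open>G \<epsilon>\<close> behind this identity fails for singular \<^term>\<open>G 0\<close>; the limit recovers it.\<close>
  have "psi1 (T 0) ** (J 0 ** Q 0) = \<kappa> *\<^sub>M mat 1"
  proof (rule tendsto_unique)
    show "((\<lambda>\<epsilon>. psi1 (T \<epsilon>) ** (J \<epsilon> ** Q \<epsilon>)) \<longlongrightarrow> psi1 (T 0) ** (J 0 ** Q 0)) (at 0)"
      by (intro matmult.tendsto lim_JQ isCont_tendsto_compose[OF isCont_psi1 lim_T])
    show "((\<lambda>\<epsilon>. psi1 (T \<epsilon>) ** (J \<epsilon> ** Q \<epsilon>)) \<longlongrightarrow> \<kappa> *\<^sub>M mat 1) (at 0)"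
      by (rule tendsto_eventually) (use ev_G psi in \<open>auto elim: eventually_mono\<close>)
  qed simp
  moreover have psi_inv: "psi1 (T \<epsilon>) ** ((1 / \<kappa>) *\<^sub>M (J \<epsilon> ** Q \<epsilon>)) = mat 1"
    if "psi1 (T \<epsilon>) ** (J \<epsilon> ** Q \<epsilon>) = \<kappa> *\<^sub>M mat 1" for \<epsilon>
    using that \<kappa> by (simp add: cscale_simps)
  ultimately have inv_psi: "invertible (psi1 Y)" and L_eq: "L = (1 / \<kappa>) *\<^sub>M (J 0 ** Q 0)"
    using matrix_inv_unique_right[OF psi_inv] by (simp_all add: L_def Y_eq)

  \<comment> \<open>The matrix in the inverse factors as \<open>T \<epsilon>\<close> times
    \<open>psi1 (T \<epsilon>)\<close>. The product equal to \<kappa> I has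
    \<open>J \<epsilon>\<close> as a factor, so \<open>J \<epsilon>\<close> is invertible, and with
    \<open>G \<epsilon>\<close> also \<open>T \<epsilon>\<close>, which then cancels. What remains
    is continuous at 0.\<close>
  have "matrix_inv (mexp (Y\<^sub>\<epsilon> \<epsilon>) - mat 1) ** Y\<^sub>\<epsilon> \<epsilon> = (1 / \<kappa>) *\<^sub>M (J \<epsilon> ** Q \<epsilon>)"
    if \<epsilon>: "\<epsilon> \<in> U \<and> invertible (G \<epsilon>)" for \<epsilon>
  proof -
    note p = psi_inv[OF psi[OF conjunct1[OF \<epsilon>] conjunct2[OF \<epsilon>]]]
    have ip: "invertible (psi1 (T \<epsilon>))" "matrix_inv (psi1 (T \<epsilon>)) = (1 / \<kappa>) *\<^sub>M (J \<epsilon> ** Q \<epsilon>)"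
      using matrix_inv_unique_right[OF p] by auto
    have "((1 / \<kappa>) *\<^sub>M psi1 (T \<epsilon>)) ** (J \<epsilon> ** Q \<epsilon>) = mat 1" using p by (simp add: cscale_simps)
    then have "invertible (((1 / \<kappa>) *\<^sub>M psi1 (T \<epsilon>)) ** (J \<epsilon> ** Q \<epsilon>))"
      by (simp add: invertible_det_nz)
    then have "invertible (J \<epsilon>)" by (simp add: invertible_matrix_mult_iff)
    then have "invertible (G \<epsilon> ** J \<epsilon>)" using \<epsilon> by (simp add: invertible_matrix_mult_iff)
    then have "T \<epsilon> ** ((- \<i>) *\<^sub>M matrix_inv (G \<epsilon> ** J \<epsilon>)) = mat 1"
      by (simp add: T_def cscale_simps matrix_inv_mult)
    then have iT: "invertible (T \<epsilon>)" by (rule matrix_inv_unique_right)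
    have "matrix_inv (mexp (T \<epsilon>) - mat 1) ** T \<epsilon> = matrix_inv (psi1 (T \<epsilon>)) ** (matrix_inv (T \<epsilon>) ** T \<epsilon>)"
      unfolding psi1_mult[symmetric] matrix_inv_mult_distrib[OF iT ip(1)] by (simp add: matrix_mul_assoc)
    then show ?thesis
      using Y\<epsilon>_eq[OF conjunct1[OF \<epsilon>]] ip(2) by (simp add: matrix_inv_mult[OF iT])
  qed
  then have ev_L: "\<forall>\<^sub>F \<epsilon> in at 0. (1 / \<kappa>) *\<^sub>M (J \<epsilon> ** Q \<epsilon>) = matrix_inv (mexp (Y\<^sub>\<epsilon> \<epsilon>) - mat 1) ** Y\<^sub>\<epsilon> \<epsilon>"
    using ev_G by (auto elim: eventually_mono)
  have lim_L: "((\<lambda>\<epsilon>. matrix_inv (mexp (Y\<^sub>\<epsilon> \<epsilon>) - mat 1) ** Y\<^sub>\<epsilon> \<epsilon>) \<longlongrightarrow> L) (at 0)"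
    unfolding L_eq
    by (rule Lim_transform_eventually[OF _ ev_L]) (intro cscale.tendsto tendsto_const lim_JQ)

  \<comment> \<open>The integral formula at \<epsilon> = 0\<close>
  interpret p0: pencil_arc "F 0" "G 0" \<alpha> \<beta> \<theta>\<^sub>1 \<theta>\<^sub>2 by (rule arc[OF U(1)])
  have FJ: "F 0 ** J 0 = J 0 ** F 0"
    using p0.F_G_commute(3)[OF p0.b_in] unfolding J_eq[OF U(1)] .
  have "Q 0 ** mexp Y = F 0 - cis (- \<theta>\<^sub>2) *\<^sub>M G 0"
    using p0.mexp_arc_log unfolding T_eq[OF U(1)] Y_eq Q_def by simp
  \<comment> \<open>The two coefficients are chosen so that the terms in \<open>G 0\<close> cancel;
    the scalar left on \<open>F 0\<close> is \<kappa> divided by \<i>.\<close>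
  then have "Q 0 ** (cis (- \<theta>\<^sub>2) *\<^sub>M mat 1 - cis (- \<theta>\<^sub>1) *\<^sub>M mexp Y)
      = cis (- \<theta>\<^sub>2) *\<^sub>M Q 0 - cis (- \<theta>\<^sub>1) *\<^sub>M (F 0 - cis (- \<theta>\<^sub>2) *\<^sub>M G 0)"
    by (simp add: matmult.diff_right cscale_simps)
  also have "\<dots> = (cis (- \<theta>\<^sub>2) - cis (- \<theta>\<^sub>1)) *\<^sub>M F 0"
    by (simp add: Q_def vec_eq_iff cscale_def algebra_simps)
  finally have "L ** (cis (- \<theta>\<^sub>2) *\<^sub>M mat 1 - cis (- \<theta>\<^sub>1) *\<^sub>M mexp Y)
      = ((1 / \<kappa>) * (cis (- \<theta>\<^sub>2) - cis (- \<theta>\<^sub>1))) *\<^sub>M (J 0 ** F 0)"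
    unfolding L_eq cscale_mult_left matrix_mul_assoc[symmetric] by (simp only: cscale_simps)
  also have "(1 / \<kappa>) * (cis (- \<theta>\<^sub>2) - cis (- \<theta>\<^sub>1)) = - \<i>"
    using \<kappa> by (simp add: \<kappa>_def divide_simps)
  finally have Lc: "L ** (cis (- \<theta>\<^sub>2) *\<^sub>M mat 1 - cis (- \<theta>\<^sub>1) *\<^sub>M mexp Y) = (- \<i>) *\<^sub>M (F 0 ** J 0)"
    unfolding FJ .
  \<comment> \<open>The two summands contribute the \<open>F 0\<close> and \<open>G 0\<close> parts
    of \<open>affine\<close>, so together they reduce to \<i> times \<open>J 0\<close>.\<close>
  have "- (\<alpha> *\<^sub>M ((- \<i>) *\<^sub>M (F 0 ** J 0))) + \<beta> *\<^sub>M Y = \<i> *\<^sub>M ((\<alpha> *\<^sub>M F 0 + \<beta> *\<^sub>M G 0) ** J 0)"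
    unfolding Y_eq T_def
    by (simp add: matmult.add_left cscale.add_right cscale.minus_left cscale.minus_right cscale_simps mult.commute)
  then have rhs: "(1 / \<i>) *\<^sub>M (Wi ** (- (\<alpha> *\<^sub>M (L ** (cis (- \<theta>\<^sub>2) *\<^sub>M mat 1 - cis (- \<theta>\<^sub>1) *\<^sub>M mexp Y))) + \<beta> *\<^sub>M Y))
      = Wi ** J 0"
    unfolding Lc affine by (simp add: cscale_simps)
  \<comment> \<open>At \<epsilon> = 0 the original pencil is the normalised one times
    \<open>W\<close> on the right, so inversion puts the inverse of \<open>W\<close> on the
    left.\<close>
  have res_eq: "resolvent A E (cis \<theta>) = Wi ** p0.res \<theta>" if \<theta>: "\<theta> \<in> {\<theta>\<^sub>1..\<theta>\<^sub>2}" for \<theta>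
  proof -
    have "(cis \<theta> *\<^sub>M F 0 - G 0) ** W = cis \<theta> *\<^sub>M (cmat E ** (Wi ** W)) - cmat A ** (Wi ** W)"
      by (simp add: F_def G_def A\<epsilon>_def E\<epsilon>_def cscale.zero_left matmult.diff_left cscale_simps matrix_mul_assoc)
    then have "cis \<theta> *\<^sub>M cmat E - cmat A = (cis \<theta> *\<^sub>M F 0 - G 0) ** W" by (simp add: WWi)
    then show ?thesis
      unfolding resolvent_def p0.res_def Wi_def
      by (simp add: matrix_inv_mult_distrib[OF N0[OF \<theta>] W_inv])
  qed
  have "((\<lambda>\<theta>. Wi ** p0.res \<theta>) has_integral Wi ** J 0) {\<theta>\<^sub>1..\<theta>\<^sub>2}"
    using has_integral_linear[OF integrable_integral[OF p0.res_integrable[OF p0.b_in]] matmult.bounded_linear_right]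
    unfolding o_def p0.int_res_def[symmetric] J_eq[OF U(1)] .
  then have "((\<lambda>\<theta>. resolvent A E (cis \<theta>)) has_integral Wi ** J 0) {\<theta>\<^sub>1..\<theta>\<^sub>2}"
    by (rule has_integral_eq[rotated]) (rule res_eq[symmetric])
  then show ?thesis
    unfolding Wi_def[symmetric] rhs using lim_Y inv_psi lim_L by blast
qed

end
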